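(* Consider the noisy search problem and the sorted Posterior Matching strategy ($sortPM$) described in the context, run with the variable-length stopping rule. For resolution $\delta>0$ and reliability $0<\epsilon<1$, the expected search time satisfies $$\mathbb{E}[\tau_{\epsilon,\delta}] \le \frac{\log(1/\delta)}{I(1/2,\,p[\alpha])} + \frac{\log(1/\epsilon)}{C_1(p[\delta])} + o\Big(\log\frac{1}{\delta\epsilon}\Big),$$ for any fixed $\alpha > \big(e\log\frac{1}{\delta\epsilon}\big)^{-K_s}$, where $$K_s := \max\Big\{\tfrac12 D\big(\tfrac14 B_1+\tfrac34 B_0 \,\big\|\, B_0\big),\ \tfrac18 D\big(B_1 \,\big\|\, \tfrac34 B_1+\tfrac14 B_0\big)\Big\}>0,$$ with $B_1=\mathrm{Bern}(1-p[1/2])$, $B_0=\mathrm{Bern}(p[1/2])$.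
   Context: Search problem: fix $\delta\in(0,1)$ with $N=1/\delta$ an integer. A target index $\theta$ is uniformly distributed on $\{1,\dots,N\}$. A noise profile $p:(0,1)\to(0,1/2)$ is continuous and non-decreasing; write $p[x]:=p(x)$. At each time $t=1,2,\dots$ an agent chooses a query set $S_t\subseteq\{1,\dots,N\}$ as a function of past queries and observations, and observes $Y_t=\mathbb{1}(\theta\in S_t)\oplus Z_t$ ($\oplus$ = XOR), where conditionally on $S_t$, $Z_t\sim\mathrm{Bern}(p[\delta|S_t|])$, conditionally i.i.d. across time. The posterior is $\pi_i(t)=\mathbb{P}(\theta=i\mid S_1,\dots,S_t,Y_1,\dots,Y_t)$ with $\pi_i(0)=\delta$; for $S\subseteq\{1,\dots,N\}$ write $\pi_S=\sum_{i\in S}\pi_i$. Variable-length stopping rule: $\tau_{\epsilon,\delta}$ is the first $t$ with $\max_i\pi_i(t)>1-\epsilon$, and the estimate is $\hat\theta=\arg\max_i\pi_i(\tau)$. $sortPM$: at time $t$, let $\sigma_t$ be a permutation ranking the entries of $\pi(t)$ in descending order ($\sigma_t(i)=j$ means $\pi_i(t)$ is the $j$-th largest entry $\pi^{\downarrow}_j(t)$). Let $k^*=\arg\min_k\big|\sum_{j=1}^k\pi^{\downarrow}_j(t)-\tfrac12\big|$ and query $S_{t+1}=\{i:\sigma_t(i)\in\{1,\dots,k^*\}\}$. Notation: $D(P\|Q)=\sum_x P(x)\log\frac{P(x)}{Q(x)}$ is KL divergence; a convex combination of Bernoulli distributions denotes their mixture. $I(q,p)$ is the mutual information between input $X\sim\mathrm{Bern}(q)$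 and the output of a binary symmetric channel with crossover probability $p$. $C_1(p):=D(\mathrm{Bern}(p)\|\mathrm{Bern}(1-p))$. The $o(\cdot)$ term is as $\delta\to0$ or $\epsilon\to0$. *)

theory Defs
  imports "HOL-Probability.Probability"
begin

definition KL :: "bool pmf \<Rightarrow> bool pmf \<Rightarrow> real" where
  "KL P Q = (\<Sum>x\<in>UNIV. if pmf P x = 0 then 0 else pmf P x * ln (pmf P x / pmf Q x))"

definition mix_pmf :: "real \<Rightarrow> 'a pmf \<Rightarrow> 'a pmf \<Rightarrow> 'a pmf" where
  "mix_pmf w P Q = bind_pmf (bernoulli_pmf w) (\<lambda>b. if b then P else Q)"

definition mutual_info :: "('a::finite \<times> 'b::finite) pmf \<Rightarrow> real" where
  "mutual_info J = (\<Sum>xy\<in>UNIV. if pmf J xy = 0 then 0 else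
      pmf J xy * ln (pmf J xy / (pmf (map_pmf fst J) (fst xy) * pmf (map_pmf snd J) (snd xy))))"

definition bsc_joint :: "real \<Rightarrow> real \<Rightarrow> (bool \<times> bool) pmf" where
  "bsc_joint q p = bind_pmf (bernoulli_pmf q) (\<lambda>x. map_pmf (\<lambda>z. (x, x \<noteq> z)) (bernoulli_pmf p))"

definition I_bsc :: "real \<Rightarrow> real \<Rightarrow> real" where
  "I_bsc q p = mutual_info (bsc_joint q p)"

definition C1 :: "real \<Rightarrow> real" where
  "C1 p = KL (bernoulli_pmf p) (bernoulli_pmf (1 - p))"

definition Ks :: "(real \<Rightarrow> real) \<Rightarrow> real" where
  "Ks p = (let B1 = bernoulli_pmf (1 - p (1/2)); B0 = bernoulli_pmf (p (1/2)) in
     max ((1/2) * KL (mix_pmf (1/4) B1 B0) B0) ((1/8) * KL B1 (mix_pmf (3/4) B1 B0)))"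

text \<open>Indices are 1..N, delta = 1/N.  A posterior is a function nat => real (zero outside 1..N).\<close>

text \<open>Ranking of indices by descending posterior (ties broken by smaller index, stable sort).\<close>
definition sorted_idx :: "nat \<Rightarrow> (nat \<Rightarrow> real) \<Rightarrow> nat list" where
  "sorted_idx N \<pi> = sort_key (\<lambda>i. - \<pi> i) [1..<N+1]"

definition top_sum :: "nat \<Rightarrow> (nat \<Rightarrow> real) \<Rightarrow> nat \<Rightarrow> real" where
  "top_sum N \<pi> k = (\<Sum>j<k. \<pi> (sorted_idx N \<pi> ! j))"

definition kstar :: "nat \<Rightarrow> (nat \<Rightarrow> real) \<Rightarrow> nat" where
  "kstar N \<pi> = (LEAST k. k \<in> {1..N} \<and>
      (\<forall>j\<in>{1..N}. \<bar>top_sum N \<pi> k - 1/2\<bar> \<le> \<bar>top_sum N \<pi> j - 1/2\<bar>))"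

definition sortPM :: "nat \<Rightarrow> (nat \<Rightarrow> real) \<Rightarrow> nat set" where
  "sortPM N \<pi> = set (take (kstar N \<pi>) (sorted_idx N \<pi>))"

definition bayes_update :: "nat \<Rightarrow> (nat \<Rightarrow> real) \<Rightarrow> nat set \<Rightarrow> real \<Rightarrow> bool \<Rightarrow> (nat \<Rightarrow> real)" where
  "bayes_update N \<pi> S q y =
     (let lik = (\<lambda>i. if y = (i \<in> S) then 1 - q else q)
      in (\<lambda>i. \<pi> i * lik i / (\<Sum>j\<in>{1..N}. \<pi> j * lik j)))"

definition max_post :: "nat \<Rightarrow> (nat \<Rightarrow> real) \<Rightarrow> real" where
  "max_post N \<pi> = Max (\<pi> ` {1..N})"

text \<open>One time step of the (stopped) process on states (theta, posterior):
  once max_i pi_i > 1 - eps the process is frozen (the search has stopped).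
  Otherwise query S = sortPM, draw Z ~ Bern(p(delta |S|)), observe Y = 1(theta in S) xor Z,
  and update the posterior by Bayes' rule.\<close>
definition search_step :: "(real \<Rightarrow> real) \<Rightarrow> nat \<Rightarrow> real \<Rightarrow> nat \<times> (nat \<Rightarrow> real) \<Rightarrow> (nat \<times> (nat \<Rightarrow> real)) pmf" where
  "search_step p N \<epsilon> s =
     (let \<theta> = fst s; \<pi> = snd s in
      if max_post N \<pi> > 1 - \<epsilon> then return_pmf s
      else (let S = sortPM N \<pi>; q = p (real (card S) / real N) in
            map_pmf (\<lambda>z. (\<theta>, bayes_update N \<pi> S q ((\<theta> \<in> S) \<noteq> z))) (bernoulli_pmf q)))"

definition search_init :: "nat \<Rightarrow> (nat \<times> (nat \<Rightarrow> real)) pmf" where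
  "search_init N = map_pmf (\<lambda>\<theta>. (\<theta>, \<lambda>i. if i \<in> {1..N} then 1 / real N else 0)) (pmf_of_set {1..N})"

definition search_state :: "(real \<Rightarrow> real) \<Rightarrow> nat \<Rightarrow> real \<Rightarrow> nat \<Rightarrow> (nat \<times> (nat \<Rightarrow> real)) pmf" where
  "search_state p N \<epsilon> t = ((\<lambda>d. bind_pmf d (search_step p N \<epsilon>)) ^^ t) (search_init N)"

text \<open>E[tau] = sum_{t>=0} P(tau > t), and tau > t iff the (stopped) posterior at time t
  still has max_i pi_i(t) <= 1 - eps.  Value in ennreal (may be infinite).\<close>
definition expected_tau :: "(real \<Rightarrow> real) \<Rightarrow> nat \<Rightarrow> real \<Rightarrow> ennreal" where
  "expected_tau p N \<epsilon> =
     (\<Sum>t. ennreal (measure_pmf.prob (search_state p N \<epsilon> t) {s. max_post N (snd s) \<le> 1 - \<epsilon>}))"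

end

(* Averaged over the target, the expected remaining search time from a posterior pi is bounded by
   any nonnegative function of pi whose expected one-step change is at most -1 before stopping.
   Such a function is a weighted sum of four supermartingales:
   - the Shannon entropy, which loses I(pi_S, q) per step; this is about I(1/2, p[alpha]) while all
     entries of pi are small and |S| <= alpha N;
   - (sum_i sqrt pi_i) / sqrt N, which starts at 1 and loses a constant when the entries are small
     and |S| > alpha N, since then the posterior is spread over a constant fraction of the indices;
   - 1 - sum_i pi_i^2, which loses a constant when the largest entry is neither small nor near 1;
   - a constant minus sum_i (- ln (1 - pi_i)), which loses about C_1(p[1/N]) when the largest entry is
     near 1, because the query is then a singleton.
   The second and third have bounded initial values, so only the entropy and the logarithmic part
   contribute to the leading terms, with factors that can be taken arbitrarily close to
   1 / I(1/2, p[alpha]) and 1 / C_1(p[1/N]). *)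
theory Submission
  imports Defs
begin

section \<open>The posterior chain\<close>

lemma prob_bind_pmf:
  "measure_pmf.prob (bind_pmf M f) A = measure_pmf.expectation M (\<lambda>x. measure_pmf.prob (f x) A)"
proof -
  have int: "integrable (measure_pmf M) (\<lambda>x. measure_pmf.prob (f x) A)"
    by (rule measure_pmf.integrable_const_bound[where B = 1]) auto
  have "ennreal (measure_pmf.prob (bind_pmf M f) A) = (\<integral>\<^sup>+x. ennreal (measure_pmf.prob (f x) A) \<partial>M)"
    by (simp flip: measure_pmf.emeasure_eq_measure)
  also have "\<dots> = ennreal (measure_pmf.expectation M (\<lambda>x. measure_pmf.prob (f x) A))"
    by (rule nn_integral_eq_integral[OF int]) simp
  finally show ?thesis
    by (subst (asm) ennreal_inj) (auto intro!: integral_nonneg_AE)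
qed

text \<open>Iterating a kernel commutes with mixing over the initial state, so one may condition on
  that state. This serves both the split after the first step and the average over the uniform
  prior.\<close>

lemma funpow_bind_pmf:
  fixes K :: "'a \<Rightarrow> 'a pmf"
  shows "((\<lambda>d. bind_pmf d K) ^^ t) d = bind_pmf d (\<lambda>s. ((\<lambda>d. bind_pmf d K) ^^ t) (return_pmf s))"
proof (induction t)
  case 0
  show ?case by (simp add: bind_return_pmf')
next
  case (Suc t)
  have "((\<lambda>d. bind_pmf d K) ^^ Suc t) d = bind_pmf (((\<lambda>d. bind_pmf d K) ^^ t) d) K" by simp
  also have "\<dots> = bind_pmf (bind_pmf d (\<lambda>s. ((\<lambda>d. bind_pmf d K) ^^ t) (return_pmf s))) K"
    using Suc.IH by (rule arg_cong)
  finally show ?case by (simp add: bind_assoc_pmf)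
qed

text \<open>The process is frozen after stopping, so the state at time \<open>t\<close> alone shows
  whether it has stopped by then. Summing over \<open>t\<close> gives the expected remaining search
  time from \<open>s\<close>.\<close>

definition alive :: "(real \<Rightarrow> real) \<Rightarrow> nat \<Rightarrow> real \<Rightarrow> nat \<Rightarrow> nat \<times> (nat \<Rightarrow> real) \<Rightarrow> real" where
  "alive p N \<epsilon> t s = measure_pmf.prob
     (((\<lambda>d. bind_pmf d (search_step p N \<epsilon>)) ^^ t) (return_pmf s)) {s. max_post N (snd s) \<le> 1 - \<epsilon>}"

lemma alive_Suc:
  "alive p N \<epsilon> (Suc t) s = measure_pmf.expectation (search_step p N \<epsilon> s) (alive p N \<epsilon> t)"
  unfolding alive_def
  by (subst funpow_Suc_right, simp add: bind_return_pmf, subst funpow_bind_pmf, simp add: prob_bind_pmf)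

lemma alive_stopped: "max_post N (snd s) > 1 - \<epsilon> \<Longrightarrow> alive p N \<epsilon> t s = 0"
  by (induction t) (auto simp: alive_Suc search_step_def alive_def[of _ _ _ 0] Let_def)

lemma alive_0: "max_post N (snd s) \<le> 1 - \<epsilon> \<Longrightarrow> alive p N \<epsilon> 0 s = 1"
  by (simp add: alive_def)

definition noise :: "(real \<Rightarrow> real) \<Rightarrow> nat \<Rightarrow> (nat \<Rightarrow> real) \<Rightarrow> real" where
  "noise p N \<pi> = p (real (card (sortPM N \<pi>)) / real N)"

definition update :: "(real \<Rightarrow> real) \<Rightarrow> nat \<Rightarrow> (nat \<Rightarrow> real) \<Rightarrow> bool \<Rightarrow> nat \<Rightarrow> real" where
  "update p N \<pi> y = bayes_update N \<pi> (sortPM N \<pi>) (noise p N \<pi>) y"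

definition lik :: "nat set \<Rightarrow> real \<Rightarrow> bool \<Rightarrow> nat \<Rightarrow> real" where
  "lik S q y i = (if y = (i \<in> S) then 1 - q else q)"

text \<open>The predictive probability of the observation \<open>y\<close> when the target has law
  \<open>\<pi>\<close>; it is also the normalizing constant in Bayes' rule.\<close>

definition evid :: "nat \<Rightarrow> (nat \<Rightarrow> real) \<Rightarrow> nat set \<Rightarrow> real \<Rightarrow> bool \<Rightarrow> real" where
  "evid N \<pi> S q y = (\<Sum>j\<in>{1..N}. \<pi> j * lik S q y j)"

lemma bayes_update_lik: "bayes_update N \<pi> S q y i = \<pi> i * lik S q y i / evid N \<pi> S q y"
  by (simp add: bayes_update_def lik_def evid_def Let_def)

lemma alive_Suc_running:
  assumes "max_post N \<pi> \<le> 1 - \<epsilon>" "0 \<le> noise p N \<pi>" "noise p N \<pi> \<le> 1"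
  shows "alive p N \<epsilon> (Suc t) (\<theta>, \<pi>) =
    (\<Sum>y\<in>UNIV. lik (sortPM N \<pi>) (noise p N \<pi>) y \<theta> * alive p N \<epsilon> t (\<theta>, update p N \<pi> y))"
  using assms
  by (auto simp: alive_Suc search_step_def noise_def update_def Let_def lik_def UNIV_bool)

text \<open>First-step analysis. With a truncated horizon every sum is a finite real, and no
  finiteness of the search time has to be known beforehand.\<close>

lemma running_sum_Suc:
  assumes "max_post N \<pi> \<le> 1 - \<epsilon>" "0 \<le> noise p N \<pi>" "noise p N \<pi> \<le> 1"
  shows "(\<Sum>t<Suc n. alive p N \<epsilon> t (\<theta>, \<pi>)) =
    1 + (\<Sum>y\<in>UNIV. lik (sortPM N \<pi>) (noise p N \<pi>) y \<theta> * (\<Sum>t<n. alive p N \<epsilon> t (\<theta>, update p N \<pi> y)))"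
proof -
  have "(\<Sum>t<Suc n. alive p N \<epsilon> t (\<theta>, \<pi>)) =
      alive p N \<epsilon> 0 (\<theta>, \<pi>) + (\<Sum>t<n. alive p N \<epsilon> (Suc t) (\<theta>, \<pi>))"
    by (rule sum.lessThan_Suc_shift)
  also have "\<dots> = 1 + (\<Sum>t<n. \<Sum>y\<in>UNIV. lik (sortPM N \<pi>) (noise p N \<pi>) y \<theta>
      * alive p N \<epsilon> t (\<theta>, update p N \<pi> y))"
    using assms alive_0[of N "(\<theta>, \<pi>)" \<epsilon> p] by (simp add: alive_Suc_running)
  finally show ?thesis
    unfolding sum_distrib_left by (subst (asm) sum.swap)
qed

definition posterior :: "nat \<Rightarrow> (nat \<Rightarrow> real) \<Rightarrow> bool" where
  "posterior N \<pi> \<longleftrightarrow> (\<forall>i\<in>{1..N}. 0 < \<pi> i) \<and> (\<Sum>i\<in>{1..N}. \<pi> i) = 1"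

lemma posterior_pos: "posterior N \<pi> \<Longrightarrow> i \<in> {1..N} \<Longrightarrow> 0 < \<pi> i"
  and posterior_sum: "posterior N \<pi> \<Longrightarrow> (\<Sum>i\<in>{1..N}. \<pi> i) = 1"
  by (auto simp: posterior_def)

lemma posterior_le_1: "posterior N \<pi> \<Longrightarrow> i \<in> {1..N} \<Longrightarrow> \<pi> i \<le> 1"
  using sum_mono2[of "{1..N}" "{i}" \<pi>] by (auto simp: posterior_def less_imp_le)

text \<open>Given the observations, the target has law \<open>\<pi>\<close>; averaging over \<open>\<theta> \<sim> \<pi>\<close> inside the
  induction replaces the disintegration of the joint law of target and posterior.\<close>

lemma lyapunov_bound:
  assumes post: "\<And>\<pi>. G \<pi> \<Longrightarrow> posterior N \<pi>"
    and nonneg: "\<And>\<pi>. G \<pi> \<Longrightarrow> 0 \<le> W \<pi>"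
    and noise: "\<And>\<pi>. G \<pi> \<Longrightarrow> max_post N \<pi> \<le> 1 - \<epsilon> \<Longrightarrow> 0 < noise p N \<pi> \<and> noise p N \<pi> < 1"
    and inv: "\<And>\<pi> y. G \<pi> \<Longrightarrow> max_post N \<pi> \<le> 1 - \<epsilon> \<Longrightarrow> G (update p N \<pi> y)"
    and drift: "\<And>\<pi>. G \<pi> \<Longrightarrow> max_post N \<pi> \<le> 1 - \<epsilon> \<Longrightarrow>
      (\<Sum>y\<in>UNIV. evid N \<pi> (sortPM N \<pi>) (noise p N \<pi>) y * W (update p N \<pi> y)) \<le> W \<pi> - 1"
    and "G \<pi>"
  shows "(\<Sum>i\<in>{1..N}. \<pi> i * (\<Sum>t<n. alive p N \<epsilon> t (i, \<pi>))) \<le> W \<pi>"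
  using \<open>G \<pi>\<close>
proof (induction n arbitrary: \<pi>)
  case 0
  then show ?case using nonneg by simp
next
  case (Suc n)
  note G = Suc.prems
  show ?case
  proof (cases "max_post N \<pi> \<le> 1 - \<epsilon>")
    case False
    then have "(\<Sum>i\<in>{1..N}. \<pi> i * (\<Sum>t<Suc n. alive p N \<epsilon> t (i, \<pi>))) = 0"
      by (simp add: alive_stopped)
    then show ?thesis using nonneg[OF G] by simp
  next
    case True
    define S q where "S = sortPM N \<pi>" and "q = noise p N \<pi>"
    have q: "0 < q" "q < 1" using noise[OF G True] by (auto simp: q_def)
    have "N \<ge> 1" using post[OF G] by (cases "N = 0") (auto simp: posterior_def)
    have evid_pos: "0 < evid N \<pi> S q y" for y
      unfolding evid_def using post[OF G] q \<open>N \<ge> 1\<close>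
      by (intro sum_pos) (auto simp: posterior_def lik_def)
    have "(\<Sum>i\<in>{1..N}. \<pi> i * (\<Sum>t<Suc n. alive p N \<epsilon> t (i, \<pi>)))
      = (\<Sum>i\<in>{1..N}. \<pi> i + (\<Sum>y\<in>UNIV. \<pi> i * lik S q y i * (\<Sum>t<n. alive p N \<epsilon> t (i, update p N \<pi> y))))"
      using q by (intro sum.cong refl, subst running_sum_Suc[OF True])
        (simp_all add: S_def q_def sum_distrib_left mult.assoc distrib_left)
    also have "\<dots> = 1 + (\<Sum>y\<in>UNIV. \<Sum>i\<in>{1..N}. \<pi> i * lik S q y i * (\<Sum>t<n. alive p N \<epsilon> t (i, update p N \<pi> y)))"
      using post[OF G] by (subst sum.swap) (simp add: sum.distrib posterior_def)
    \<comment> \<open>Bayes' rule in product form: \<open>\<pi> i * lik S q y i\<close> is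
      \<open>evid N \<pi> S q y * update p N \<pi> y i\<close>. The inner sum becomes an average
      over the new posterior, to which the induction hypothesis applies.\<close>
    also have "\<dots> = 1 + (\<Sum>y\<in>UNIV. evid N \<pi> S q y *
        (\<Sum>i\<in>{1..N}. update p N \<pi> y i * (\<Sum>t<n. alive p N \<epsilon> t (i, update p N \<pi> y))))"
      using evid_pos
      by (simp add: sum_distrib_left update_def bayes_update_lik S_def q_def less_imp_neq[symmetric]
        del: mult_eq_0_iff)
    also have "\<dots> \<le> 1 + (\<Sum>y\<in>UNIV. evid N \<pi> S q y * W (update p N \<pi> y))"
      using Suc.IH[OF inv[OF G True]] evid_pos
      by (intro add_left_mono sum_mono mult_left_mono) (auto simp: less_imp_le)
    also have "\<dots> \<le> W \<pi>"
      using drift[OF G True] by (simp add: S_def q_def)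
    finally show ?thesis .
  qed
qed

definition uniform :: "nat \<Rightarrow> nat \<Rightarrow> real" where
  "uniform N = (\<lambda>i. if i \<in> {1..N} then 1 / real N else 0)"

text \<open>The tail-sum series for the expectation is the supremum of its partial sums, so a bound
  uniform in the horizon suffices.\<close>

lemma expected_tau_le:
  assumes N: "1 \<le> N"
    and bound: "\<And>n. (\<Sum>i\<in>{1..N}. uniform N i * (\<Sum>t<n. alive p N \<epsilon> t (i, uniform N))) \<le> B"
  shows "expected_tau p N \<epsilon> \<le> ennreal B"
proof -
  let ?A = "{s :: nat \<times> (nat \<Rightarrow> real). max_post N (snd s) \<le> 1 - \<epsilon>}"
  have init: "measure_pmf.prob (search_state p N \<epsilon> t) ?A =
      (\<Sum>i\<in>{1..N}. uniform N i * alive p N \<epsilon> t (i, uniform N))" for t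
  proof -
    have "measure_pmf.prob (search_state p N \<epsilon> t) ?A =
        measure_pmf.expectation (search_init N) (alive p N \<epsilon> t)"
      unfolding search_state_def
      by (subst funpow_bind_pmf) (simp add: prob_bind_pmf flip: alive_def)
    also have "\<dots> = (\<Sum>i\<in>{1..N}. alive p N \<epsilon> t (i, uniform N)) / N"
      unfolding search_init_def using N
      by (simp add: integral_pmf_of_set uniform_def)
    finally show ?thesis
      by (simp add: uniform_def sum_divide_distrib)
  qed
  have "expected_tau p N \<epsilon> = (SUP n. \<Sum>t<n. ennreal (measure_pmf.prob (search_state p N \<epsilon> t) ?A))"
    unfolding expected_tau_def by (rule suminf_eq_SUP)
  also have "\<dots> \<le> ennreal B"
  proof (rule SUP_least)
    fix n
    have "(\<Sum>t<n. ennreal (measure_pmf.prob (search_state p N \<epsilon> t) ?A))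
      = ennreal (\<Sum>t<n. measure_pmf.prob (search_state p N \<epsilon> t) ?A)"
      by (simp add: sum_ennreal)
    also have "(\<Sum>t<n. measure_pmf.prob (search_state p N \<epsilon> t) ?A)
      = (\<Sum>i\<in>{1..N}. uniform N i * (\<Sum>t<n. alive p N \<epsilon> t (i, uniform N)))"
      by (simp only: init sum_distrib_left) (rule sum.swap)
    finally show "(\<Sum>t<n. ennreal (measure_pmf.prob (search_state p N \<epsilon> t) ?A)) \<le> ennreal B"
      using bound[of n] by (simp add: ennreal_leI)
  qed
  finally show ?thesis .
qed

section \<open>The sorted query set\<close>

context
  fixes N :: nat and \<pi> :: "nat \<Rightarrow> real"
  assumes N: "1 \<le> N" and post: "posterior N \<pi>"
begin

lemma sorted_idx_basic:
  "set (sorted_idx N \<pi>) = {1..N}" "distinct (sorted_idx N \<pi>)" "length (sorted_idx N \<pi>) = N"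
  by (auto simp: sorted_idx_def)

lemma sorted_idx_in: "k < N \<Longrightarrow> sorted_idx N \<pi> ! k \<in> {1..N}"
  using nth_mem[of k "sorted_idx N \<pi>"] by (simp add: sorted_idx_basic)

lemma sorted_idx_antimono:
  assumes "j \<le> k" "k < N" shows "\<pi> (sorted_idx N \<pi> ! k) \<le> \<pi> (sorted_idx N \<pi> ! j)"
proof -
  have "sorted (map (\<lambda>i. - \<pi> i) (sorted_idx N \<pi>))"
    unfolding sorted_idx_def by (rule sorted_sort_key)
  from sorted_nth_mono[OF this, of j k] assms show ?thesis
    by (simp add: sorted_idx_basic)
qed

lemma top_sum_eq_sum:
  assumes "k \<le> N" shows "top_sum N \<pi> k = (\<Sum>i\<in>set (take k (sorted_idx N \<pi>)). \<pi> i)"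
proof -
  have "set (take k (sorted_idx N \<pi>)) = (\<lambda>j. sorted_idx N \<pi> ! j) ` {..<k}"
    using assms nth_image[of k "sorted_idx N \<pi>"] by (simp add: sorted_idx_basic lessThan_atLeast0)
  moreover have "inj_on (\<lambda>j. sorted_idx N \<pi> ! j) {..<k}"
    using assms by (intro inj_on_nth) (auto simp: sorted_idx_basic)
  ultimately show ?thesis by (simp add: top_sum_def sum.reindex)
qed

lemma top_sum_N: "top_sum N \<pi> N = 1"
  using post by (simp add: top_sum_eq_sum sorted_idx_basic posterior_def)

lemma top_sum_Suc: "top_sum N \<pi> (Suc k) = top_sum N \<pi> k + \<pi> (sorted_idx N \<pi> ! k)"
  by (simp add: top_sum_def)

lemmas post_pos = posterior_pos[OF post]

lemma top_sum_strict_mono: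
  assumes "j < k" "k \<le> N" shows "top_sum N \<pi> j < top_sum N \<pi> k"
proof -
  have "0 < \<pi> (sorted_idx N \<pi> ! i)" if "i < k" for i
    using that assms by (intro post_pos sorted_idx_in) auto
  then show ?thesis
    unfolding top_sum_def using assms by (intro sum_strict_mono2[of _ _ j]) (auto simp: less_imp_le)
qed

text \<open>The largest entries have at least the average value \<open>1 / N\<close>. The
  \<open>k\<close>-th largest entry \<open>a\<close> separates the two groups: those before it are
  at least \<open>a\<close>, those after it at most \<open>a\<close>.\<close>

lemma top_sum_ge_average: assumes "1 \<le> k" "k \<le> N" shows "real k \<le> real N * top_sum N \<pi> k"
proof -
  define a where "a = \<pi> (sorted_idx N \<pi> ! (k - 1))"
  have le: "real k * a \<le> top_sum N \<pi> k"
    unfolding top_sum_def using assms sorted_idx_antimono[of _ "k - 1"]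
    by (intro sum_bounded_below[where A = "{..<k}" and K = a, simplified]) (auto simp: a_def)
  have "1 - top_sum N \<pi> k = (\<Sum>j\<in>{k..<N}. \<pi> (sorted_idx N \<pi> ! j))"
    unfolding top_sum_N[symmetric] top_sum_def lessThan_atLeast0
    using assms by (subst sum.atLeastLessThan_concat[of 0 k N, symmetric]) auto
  also have "\<dots> \<le> real (card {k..<N}) * a"
    using assms sorted_idx_antimono[of "k - 1"] by (intro sum_bounded_above) (auto simp: a_def)
  finally have ge: "1 - top_sum N \<pi> k \<le> (real N - real k) * a"
    using assms by (simp add: of_nat_diff)
  have "real k * (1 - top_sum N \<pi> k) \<le> real k * ((real N - real k) * a)"
    using ge by (intro mult_left_mono) auto
  also have "\<dots> \<le> (real N - real k) * top_sum N \<pi> k"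
    using mult_left_mono[OF le, of "real N - real k"] assms by (simp add: mult_ac)
  finally show ?thesis by (simp add: algebra_simps)
qed

lemma max_post_eq: "max_post N \<pi> = \<pi> (sorted_idx N \<pi> ! 0)"
  unfolding max_post_def
proof (rule Max_eqI)
  fix y assume "y \<in> \<pi> ` {1..N}"
  then obtain i where "i \<in> set (sorted_idx N \<pi>)" "y = \<pi> i" unfolding sorted_idx_basic by blast
  then obtain k where "k < N" "y = \<pi> (sorted_idx N \<pi> ! k)"
    by (metis in_set_conv_nth sorted_idx_basic(3))
  then show "y \<le> \<pi> (sorted_idx N \<pi> ! 0)"
    using sorted_idx_antimono[of 0 k] by simp
qed (use N sorted_idx_in[of 0] in auto)

lemma max_post_top_sum: "top_sum N \<pi> 1 = max_post N \<pi>"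
  by (simp add: max_post_eq top_sum_def)

lemma le_max_post: "i \<in> {1..N} \<Longrightarrow> \<pi> i \<le> max_post N \<pi>"
  by (simp add: max_post_def)

text \<open>A minimizer exists because \<open>{1..N}\<close> is finite and nonempty, so the
  \<open>LEAST\<close> in \<open>kstar\<close> is meaningful. The empty prefix is not a candidate,
  hence the query is never empty.\<close>

lemma kstar:
  shows kstar_in: "kstar N \<pi> \<in> {1..N}"
    and kstar_min: "j \<in> {1..N} \<Longrightarrow> \<bar>top_sum N \<pi> (kstar N \<pi>) - 1/2\<bar> \<le> \<bar>top_sum N \<pi> j - 1/2\<bar>"
proof -
  let ?P = "\<lambda>k. k \<in> {1..N} \<and> (\<forall>j\<in>{1..N}. \<bar>top_sum N \<pi> k - 1/2\<bar> \<le> \<bar>top_sum N \<pi> j - 1/2\<bar>)"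
  let ?f = "\<lambda>k. \<bar>top_sum N \<pi> k - 1/2\<bar>"
  have "Min (?f ` {1..N}) \<in> ?f ` {1..N}" using N by (intro Min_in) auto
  then obtain k where k: "Min (?f ` {1..N}) = ?f k" "k \<in> {1..N}" by (rule imageE)
  have "?P k"
  proof (intro conjI ballI k)
    fix j assume "j \<in> {1..N}"
    then have "Min (?f ` {1..N}) \<le> ?f j" by (intro Min_le imageI finite_imageI finite_atLeastAtMost)
    then show "?f k \<le> ?f j" unfolding k .
  qed
  then have "\<exists>k. ?P k" by (rule exI[where P = ?P])
  then have P: "?P (kstar N \<pi>)" unfolding kstar_def by (rule LeastI_ex)
  show "kstar N \<pi> \<in> {1..N}" using P by (rule conjunct1)
  show "\<bar>top_sum N \<pi> (kstar N \<pi>) - 1/2\<bar> \<le> \<bar>top_sum N \<pi> j - 1/2\<bar>" if "j \<in> {1..N}"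
    using conjunct2[OF P] that by (rule bspec)
qed

lemma kstar_le:
  assumes "k \<in> {1..N}" "\<And>j. j \<in> {1..N} \<Longrightarrow> \<bar>top_sum N \<pi> k - 1/2\<bar> \<le> \<bar>top_sum N \<pi> j - 1/2\<bar>"
  shows "kstar N \<pi> \<le> k"
  unfolding kstar_def using assms by (intro Least_le conjI ballI)

lemma card_sortPM: "card (sortPM N \<pi>) = kstar N \<pi>"
proof -
  have "card (sortPM N \<pi>) = length (take (kstar N \<pi>) (sorted_idx N \<pi>))"
    unfolding sortPM_def by (intro distinct_card distinct_take sorted_idx_basic)
  then show ?thesis using kstar_in by (simp add: sorted_idx_basic)
qed

lemma sortPM_subset: "sortPM N \<pi> \<subseteq> {1..N}"
  unfolding sortPM_def by (rule order_trans[OF set_take_subset]) (simp add: sorted_idx_basic)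

lemma sum_sortPM: "(\<Sum>i\<in>sortPM N \<pi>. \<pi> i) = top_sum N \<pi> (kstar N \<pi>)"
  unfolding sortPM_def using kstar_in by (intro top_sum_eq_sum[symmetric]) simp

lemma sortPM_top:
  assumes "i \<in> sortPM N \<pi>" "j \<in> {1..N} - sortPM N \<pi>"
  shows "\<pi> j \<le> \<pi> i"
proof -
  let ?xs = "sorted_idx N \<pi>"
  obtain a where a: "a < kstar N \<pi>" "i = ?xs ! a"
    using assms(1) unfolding sortPM_def in_set_conv_nth by auto
  have "j \<in> set ?xs" unfolding sorted_idx_basic using assms(2) by blast
  then obtain b where b: "b < N" "j = ?xs ! b"
    unfolding in_set_conv_nth sorted_idx_basic(3) by blast
  have "kstar N \<pi> \<le> b"
  proof (rule ccontr)
    assume "\<not> kstar N \<pi> \<le> b"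
    then have "j \<in> sortPM N \<pi>"
      unfolding sortPM_def in_set_conv_nth using b
      by (intro exI[of _ b]) (simp add: sorted_idx_basic)
    then show False using assms(2) by blast
  qed
  then show ?thesis using a b by (auto intro: sorted_idx_antimono)
qed

lemma max_in_sortPM: "\<exists>m\<in>sortPM N \<pi>. \<pi> m = max_post N \<pi>"
proof
  show "sorted_idx N \<pi> ! 0 \<in> sortPM N \<pi>"
    unfolding sortPM_def in_set_conv_nth using kstar_in N
    by (intro exI[of _ 0]) (simp add: sorted_idx_basic)
qed (rule max_post_eq[symmetric])

text \<open>This keeps the noise at most \<open>p (1/2)\<close>. If \<open>k\<close> exceeded
  \<open>N / 2\<close>, the averages would force \<open>top_sum\<close> at \<open>k\<close> and at
  \<open>k - 1\<close> to add up to at least 1. Then \<open>k - 1\<close> would be at least as close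
  to 1/2, against the choice of the least minimizer.\<close>

lemma card_sortPM_le_half:
  assumes "2 \<le> N" shows "2 * card (sortPM N \<pi>) \<le> N"
proof (rule ccontr)
  define k where "k = kstar N \<pi>"
  assume "\<not> ?thesis"
  then have k: "N + 1 \<le> 2 * k" "k \<le> N" "2 \<le> k"
    using assms kstar_in by (auto simp: card_sortPM k_def)
  have N0: "0 < real N" using N by simp
  have "real (2 * k) > N" using k by linarith
  then have "real N * (1/2) < real N * top_sum N \<pi> k"
    using top_sum_ge_average[of k] k by linarith
  then have gt: "1/2 < top_sum N \<pi> k" using N0 by (simp only: mult_less_cancel_left_pos)
  have avg': "real k - 1 \<le> real N * top_sum N \<pi> (k - 1)"
    using top_sum_ge_average[of "k - 1"] k by (simp add: of_nat_diff)
  have "real (2 * k) \<ge> N + 1" using k by linarith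
  then have "real N * 1 \<le> real N * (top_sum N \<pi> k + top_sum N \<pi> (k - 1))"
    using top_sum_ge_average[of k] avg' k unfolding distrib_left by linarith
  then have ge: "1 \<le> top_sum N \<pi> k + top_sum N \<pi> (k - 1)" using N0 by (simp only: mult_le_cancel_left_pos)
  have lt: "top_sum N \<pi> (k - 1) < top_sum N \<pi> k" using k by (intro top_sum_strict_mono) auto
  have "\<bar>top_sum N \<pi> (k - 1) - 1/2\<bar> \<le> \<bar>top_sum N \<pi> k - 1/2\<bar>"
    using gt ge lt by linarith
  then have min: "\<bar>top_sum N \<pi> (k - 1) - 1/2\<bar> \<le> \<bar>top_sum N \<pi> j - 1/2\<bar>" if "j \<in> {1..N}" for j
    using kstar_min[OF that, folded k_def] by (rule order_trans)
  have "k - 1 \<in> {1..N}" using k unfolding atLeastAtMost_iff by linarith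
  then have "kstar N \<pi> \<le> k - 1" by (rule kstar_le) (rule min)
  then show False using k by (simp add: k_def)
qed

text \<open>Once the largest entry reaches 1/2, every longer prefix lies further from 1/2.\<close>

lemma sortPM_singleton:
  assumes "1/2 \<le> max_post N \<pi>"
  obtains m where "sortPM N \<pi> = {m}" "m \<in> {1..N}" "\<pi> m = max_post N \<pi>"
proof -
  have "kstar N \<pi> \<le> 1"
  proof (rule kstar_le)
    fix j assume "j \<in> {1..N}"
    then have "top_sum N \<pi> 1 \<le> top_sum N \<pi> j"
      using top_sum_strict_mono[of 1 j] by (cases "j = 1") auto
    then show "\<bar>top_sum N \<pi> 1 - 1/2\<bar> \<le> \<bar>top_sum N \<pi> j - 1/2\<bar>"
      using assms unfolding max_post_top_sum by linarith
  qed (use N in auto)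
  then have "card (sortPM N \<pi>) = 1" using kstar_in by (simp add: card_sortPM)
  then obtain m where "sortPM N \<pi> = {m}" by (auto simp: card_1_singleton_iff)
  then show ?thesis using that max_in_sortPM sortPM_subset by auto
qed

text \<open>The prefix sums cross 1/2 by a jump of at most \<open>max_post N \<pi>\<close>, so one
  of the two prefixes around the crossing is within half a jump.\<close>

lemma sum_sortPM_near_half:
  assumes "max_post N \<pi> \<le> 1/2"
  shows "\<bar>(\<Sum>i\<in>sortPM N \<pi>. \<pi> i) - 1/2\<bar> \<le> max_post N \<pi> / 2"
proof -
  let ?P = "\<lambda>k. 1/2 \<le> top_sum N \<pi> k"
  define k where "k = (LEAST k. ?P k)"
  have Pk: "?P k" unfolding k_def by (rule LeastI[of ?P N]) (simp add: top_sum_N)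
  have "k \<le> N" unfolding k_def by (rule Least_le) (simp add: top_sum_N)
  have "k \<noteq> 0" using Pk by (intro notI) (simp add: top_sum_def)
  then obtain l where l: "k = Suc l" using not0_implies_Suc by auto
  have "\<not> ?P l" using not_less_Least[of l ?P] l by (simp add: k_def)
  have step: "top_sum N \<pi> k \<le> top_sum N \<pi> l + max_post N \<pi>"
    using l \<open>k \<le> N\<close> le_max_post[OF sorted_idx_in, of l] by (simp add: top_sum_Suc)
  have "\<bar>top_sum N \<pi> (kstar N \<pi>) - 1/2\<bar> \<le> max_post N \<pi> / 2"
  proof (cases "l = 0")
    \<comment> \<open>The prefix below the crossing is empty, hence no candidate for
      \<open>kstar\<close>. Here the assumption forces the largest entry to equal 1/2, and the
      distance is 0.\<close>
    case True
    then have "top_sum N \<pi> k = max_post N \<pi>" using l max_post_top_sum by simp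
    then show ?thesis
      using kstar_min[of 1] Pk assms max_post_top_sum N by simp
  next
    case False
    then have "\<bar>top_sum N \<pi> (kstar N \<pi>) - 1/2\<bar> \<le> \<bar>top_sum N \<pi> l - 1/2\<bar>"
      "\<bar>top_sum N \<pi> (kstar N \<pi>) - 1/2\<bar> \<le> \<bar>top_sum N \<pi> k - 1/2\<bar>"
      using kstar_min[of l] kstar_min[of k] l False \<open>k \<le> N\<close> by simp_all
    then show ?thesis using step Pk \<open>\<not> ?P l\<close> by linarith
  qed
  then show ?thesis by (simp add: sum_sortPM)
qed

text \<open>Every queried entry is at least \<open>\<pi> j\<close>. A large query therefore forces
  the entries outside it to be small, which \<open>sqrt_sum_ge\<close> exploits.\<close>

lemma outside_sortPM_le:
  assumes "j \<in> {1..N} - sortPM N \<pi>"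
  shows "\<pi> j * card (sortPM N \<pi>) \<le> (\<Sum>i\<in>sortPM N \<pi>. \<pi> i)"
  using sum_bounded_below[of "sortPM N \<pi>" "\<pi> j" \<pi>] sortPM_top[OF _ assms] by (simp add: mult.commute)

end

section \<open>One-step drift of four functionals of the posterior\<close>

text \<open>Otherwise simp turns \<open>{1..N}\<close> into \<open>{Suc 0..N}\<close>, where the facts below do not match.\<close>

declare One_nat_def [simp del]

section \<open>Binary entropy, Gibbs' inequality and the Bhattacharyya coefficient\<close>

definition binent :: "real \<Rightarrow> real" where
  "binent q = - (q * ln q + (1 - q) * ln (1 - q))"

text \<open>Nonnegativity of relative entropy, from \<open>ln x \<le> x - 1\<close> at
  \<open>x = g y / f y\<close>.\<close>

lemma gibbs_bool:
  fixes f g :: "bool \<Rightarrow> real"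
  assumes "\<And>y. 0 < f y" "\<And>y. 0 < g y" "(\<Sum>y\<in>UNIV. f y) = 1" "(\<Sum>y\<in>UNIV. g y) = 1"
  shows "(\<Sum>y\<in>UNIV. f y * ln (g y)) \<le> (\<Sum>y\<in>UNIV. f y * ln (f y))"
proof -
  have "f y * ln (g y) - f y * ln (f y) \<le> g y - f y" for y
  proof -
    have "f y * ln (g y / f y) \<le> f y * (g y / f y - 1)"
      using assms(1,2)[of y] by (intro mult_left_mono ln_le_minus_one) auto
    then show ?thesis using assms(1,2)[of y] by (simp add: ln_div algebra_simps)
  qed
  then have "(\<Sum>y\<in>UNIV. f y * ln (g y) - f y * ln (f y)) \<le> (\<Sum>y\<in>UNIV. g y - f y)"
    by (intro sum_mono)
  then show ?thesis using assms(3,4) by (simp add: sum_subtractf)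
qed

lemma gibbs_binent:
  assumes "0 < a" "a < 1" "0 < b" "b < 1"
  shows "binent a \<le> - (a * ln b + (1 - a) * ln (1 - b))"
proof -
  have "(\<Sum>y\<in>UNIV. (if y then a else 1 - a) * ln (if y then b else 1 - b))
      \<le> (\<Sum>y\<in>UNIV. (if y then a else 1 - a) * ln (if y then a else 1 - a))"
    using assms by (intro gibbs_bool) (auto simp: UNIV_bool)
  then show ?thesis by (simp add: UNIV_bool binent_def)
qed

text \<open>The cross entropy in Gibbs' inequality is affine in \<open>q\<close> with slope
  \<open>ln ((1 - r) / r)\<close>, nonnegative for \<open>r \<le> 1/2\<close>, and equals
  \<open>binent r\<close> at \<open>q = r\<close>.\<close>

lemma binent_mono:
  assumes "0 < q" "q \<le> r" "r \<le> 1/2"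
  shows "binent q \<le> binent r"
proof -
  have "binent q \<le> - (q * ln r + (1 - q) * ln (1 - r))"
    using assms by (intro gibbs_binent) auto
  moreover have "(r - q) * (ln (1 - r) - ln r) \<ge> 0"
    using assms by (intro mult_nonneg_nonneg) auto
  ultimately show ?thesis by (simp add: binent_def algebra_simps)
qed

lemma binent_minus: "binent (1 - q) = binent q"
  by (simp add: binent_def)

text \<open>The deficit from \<open>ln 2\<close> is the divergence from a fair coin, which the
  chi-square distance \<open>(2 * x - 1)\<^sup>2\<close> dominates.\<close>

lemma binent_ge:
  assumes "0 < x" "x < 1" shows "ln 2 - (2 * x - 1)\<^sup>2 \<le> binent x"
proof -
  have "x * ln (2 * x) \<le> x * (2 * x - 1)" "(1 - x) * ln (2 * (1 - x)) \<le> (1 - x) * (2 * (1 - x) - 1)"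
    using assms by (intro mult_left_mono ln_le_minus_one; simp)+
  moreover have "ln (2 * x) = ln 2 + ln x" "ln (2 * (1 - x)) = ln 2 + ln (1 - x)"
    using ln_mult[of 2 x] ln_mult[of 2 "1 - x"] assms by auto
  ultimately have "x * (ln 2 + ln x) + (1 - x) * (ln 2 + ln (1 - x))
      \<le> x * (2 * x - 1) + (1 - x) * (2 * (1 - x) - 1)"
    by simp
  then show ?thesis
    by (simp add: binent_def power2_eq_square algebra_simps)
qed

text \<open>Strictness comes from \<open>ln x < x - 1\<close> at \<open>x = 1 / (2 * q)\<close>,
  which differs from 1. It makes the information rate in the leading term positive.\<close>

lemma binent_less_ln2:
  assumes "0 < q" "q < 1/2" shows "binent q < ln 2"
proof -
  have "ln (1 / (2 * q)) < 1 / (2 * q) - 1"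
    using assms ln_le_minus_one[of "1 / (2 * q)"] ln_eq_minus_one[of "1 / (2 * q)"]
    by (cases "ln (1 / (2 * q)) = 1 / (2 * q) - 1") auto
  then have "q * ln (1 / (2 * q)) < q * (1 / (2 * q) - 1)"
    using assms by (intro mult_strict_left_mono) auto
  moreover have "(1 - q) * ln (1 / (2 * (1 - q))) \<le> (1 - q) * (1 / (2 * (1 - q)) - 1)"
    using assms by (intro mult_left_mono ln_le_minus_one) auto
  moreover have "q * (1 / (2 * q) - 1) = 1 / 2 - q" "(1 - q) * (1 / (2 * (1 - q)) - 1) = q - 1 / 2"
    using assms by (simp_all add: field_simps)
  moreover have "ln (1 / (2 * q)) = - ln 2 - ln q" "ln (1 / (2 * (1 - q))) = - ln 2 - ln (1 - q)"
    using assms ln_mult[of 2 q] ln_mult[of 2 "1 - q"] by (simp_all only: ln_div) auto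
  ultimately have "q * (- ln 2 - ln q) + (1 - q) * (- ln 2 - ln (1 - q)) < 0" by simp
  then show ?thesis by (simp add: binent_def algebra_simps)
qed

text \<open>The left side is 1 minus half the sum of two squares
  \<open>(sqrt x - sqrt y)\<^sup>2\<close>. Since \<open>sqrt x + sqrt y \<le> 2\<close>, each of
  them is at least \<open>(x - y)\<^sup>2 / 4\<close>.\<close>

lemma bhattacharyya:
  fixes a b :: real
  assumes "0 \<le> a" "a \<le> 1" "0 \<le> b" "b \<le> 1"
  shows "sqrt (a * b) + sqrt ((1 - a) * (1 - b)) \<le> 1 - (a - b)\<^sup>2 / 4"
proof -
  have *: "sqrt (x * y) \<le> (x + y) / 2 - (x - y)\<^sup>2 / 8" if xy: "0 \<le> x" "x \<le> 1" "0 \<le> y" "y \<le> 1" for x y :: real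
  proof -
    have "x - y = (sqrt x - sqrt y) * (sqrt x + sqrt y)"
      using xy by (simp add: algebra_simps flip: power2_eq_square)
    then have "(x - y)\<^sup>2 = (sqrt x - sqrt y)\<^sup>2 * (sqrt x + sqrt y)\<^sup>2" by (simp add: power_mult_distrib)
    also have "\<dots> \<le> (sqrt x - sqrt y)\<^sup>2 * 2\<^sup>2"
    proof (intro mult_left_mono power_mono)
      show "sqrt x + sqrt y \<le> 2" using xy real_sqrt_le_1_iff[of x] real_sqrt_le_1_iff[of y] by linarith
    qed (use xy in auto)
    finally have "(x - y)\<^sup>2 \<le> (sqrt x - sqrt y)\<^sup>2 * 4" by simp
    moreover have "(sqrt x - sqrt y)\<^sup>2 = x + y - 2 * sqrt (x * y)"
      using xy by (simp add: power2_diff real_sqrt_mult)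
    ultimately show ?thesis by argo
  qed
  show ?thesis
    using *[of a b] *[of "1 - a" "1 - b"] assms power2_commute[of b a] by (simp add: field_simps)
qed

section \<open>The four functionals and their expected change under one Bayes update\<close>

definition entropy :: "nat \<Rightarrow> (nat \<Rightarrow> real) \<Rightarrow> real" where
  "entropy N \<pi> = (\<Sum>i\<in>{1..N}. - (\<pi> i * ln (\<pi> i)))"

definition sqrt_sum :: "nat \<Rightarrow> (nat \<Rightarrow> real) \<Rightarrow> real" where
  "sqrt_sum N \<pi> = (\<Sum>i\<in>{1..N}. sqrt (\<pi> i))"

definition square_sum :: "nat \<Rightarrow> (nat \<Rightarrow> real) \<Rightarrow> real" where
  "square_sum N \<pi> = (\<Sum>i\<in>{1..N}. (\<pi> i)\<^sup>2)"

definition log_sum :: "nat \<Rightarrow> (nat \<Rightarrow> real) \<Rightarrow> real" where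
  "log_sum N \<pi> = (\<Sum>i\<in>{1..N}. - ln (1 - \<pi> i))"

lemma lik_bounds:
  assumes "q \<le> 1/2" shows "q \<le> lik S q y i" "lik S q y i \<le> 1 - q"
  using assms by (auto simp: lik_def)

lemma sum_lik: "(\<Sum>y\<in>UNIV. lik S q y i) = 1"
  by (simp add: lik_def UNIV_bool)

context
  fixes N :: nat and \<pi> :: "nat \<Rightarrow> real" and S :: "nat set" and q :: real
  assumes post: "posterior N \<pi>" and S: "S \<subseteq> {1..N}" and q0: "0 < q" and q1: "q < 1/2"
begin

private abbreviation (input) "\<sigma> \<equiv> (\<Sum>i\<in>S. \<pi> i)"
private abbreviation (input) "P y \<equiv> evid N \<pi> S q y"
private abbreviation (input) "L y i \<equiv> lik S q y i"
private abbreviation (input) "\<pi>' y \<equiv> bayes_update N \<pi> S q y"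

lemmas pi_pos = posterior_pos[OF post]
  and pi_sum = posterior_sum[OF post]
  and pi_le_1 = posterior_le_1[OF post]

lemma sum_evid: "(\<Sum>y\<in>UNIV. P y) = 1"
  unfolding evid_def by (subst sum.swap) (simp add: sum_lik pi_sum flip: sum_distrib_left)

lemma evid_bounds: "q \<le> P y" "P y \<le> 1 - q"
proof -
  have "(\<Sum>j\<in>{1..N}. \<pi> j * q) \<le> P y" "P y \<le> (\<Sum>j\<in>{1..N}. \<pi> j * (1 - q))"
    unfolding evid_def using lik_bounds[of q] q1 pi_pos
    by (intro sum_mono mult_left_mono; simp add: less_imp_le)+
  then show "q \<le> P y" "P y \<le> 1 - q" by (simp_all add: pi_sum flip: sum_distrib_right)
qed

lemma evid_pos: "0 < P y" and evid_lt1: "P y < 1" and lik_pos: "0 < L y i"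
  using evid_bounds[of y] q0 q1 by (auto simp: lik_def)

lemma evid_True: "P True = \<sigma> * (1 - q) + (1 - \<sigma>) * q"
proof -
  have "P True = (\<Sum>j\<in>S. \<pi> j * (1 - q)) + (\<Sum>j\<in>{1..N} - S. \<pi> j * q)"
    unfolding evid_def using S
    by (subst sum.subset_diff[of S]) (auto simp: lik_def intro!: arg_cong2[of _ _ _ _ "(+)"] sum.cong)
  moreover have "(\<Sum>j\<in>{1..N} - S. \<pi> j) = 1 - \<sigma>"
    using S pi_sum by (simp add: sum_diff)
  ultimately show ?thesis by (simp flip: sum_distrib_right)
qed

text \<open>These gaps measure how much the answer tells about index \<open>i\<close>; the gains of
  \<open>sqrt_sum\<close> and \<open>square_sum\<close> are expressed through them.\<close>

lemma lik_diff_in: "i \<in> S \<Longrightarrow> L True i - P True = (1 - \<sigma>) * (1 - 2 * q)"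
  and lik_diff_out: "i \<notin> S \<Longrightarrow> L True i - P True = - \<sigma> * (1 - 2 * q)"
  by (simp_all add: evid_True lik_def algebra_simps)

lemma posterior_update: "posterior N (\<pi>' y)"
  unfolding posterior_def
proof
  show "\<forall>i\<in>{1..N}. 0 < \<pi>' y i"
    using pi_pos evid_pos[of y] lik_pos by (simp add: bayes_update_lik)
  show "(\<Sum>i\<in>{1..N}. \<pi>' y i) = 1"
    using evid_pos[of y] by (simp add: bayes_update_lik flip: sum_divide_distrib evid_def)
qed

lemma lik_ln: "(\<Sum>y\<in>UNIV. L y i * ln (L y i)) = - binent q"
  by (auto simp: UNIV_bool lik_def binent_def)

lemma evid_ln: "(\<Sum>y\<in>UNIV. P y * ln (P y)) = - binent (P True)"
  using sum_evid by (simp add: UNIV_bool binent_def eq_diff_eq[symmetric])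

text \<open>The loss is the mutual information \<open>H(Y) - H(Y | \<theta>)\<close> of target and
  observation; the conditional entropy is \<open>binent q\<close> whatever the target.\<close>

lemma entropy_drift: "(\<Sum>y\<in>UNIV. P y * entropy N (\<pi>' y)) = entropy N \<pi> - (binent (P True) - binent q)"
proof -
  have "P y * entropy N (\<pi>' y) =
      (\<Sum>i\<in>{1..N}. - (\<pi> i * ln (\<pi> i)) * L y i - \<pi> i * (L y i * ln (L y i))) + P y * ln (P y)" for y
  proof -
    have "P y * entropy N (\<pi>' y) = (\<Sum>i\<in>{1..N}. - (\<pi> i * L y i) * (ln (\<pi> i) + ln (L y i) - ln (P y)))"
      unfolding entropy_def sum_distrib_left
    proof (intro sum.cong refl)
      fix i assume "i \<in> {1..N}"
      then show "P y * - (\<pi>' y i * ln (\<pi>' y i)) = - (\<pi> i * L y i) * (ln (\<pi> i) + ln (L y i) - ln (P y))"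
        using pi_pos[of i] evid_pos[of y] lik_pos[of y i]
        by (simp add: bayes_update_lik ln_mult ln_div)
    qed
    also have "\<dots> = (\<Sum>i\<in>{1..N}. - (\<pi> i * ln (\<pi> i)) * L y i - \<pi> i * (L y i * ln (L y i)))
        + (\<Sum>i\<in>{1..N}. \<pi> i * L y i) * ln (P y)"
      unfolding sum_distrib_right sum.distrib[symmetric] by (intro sum.cong) (auto simp: algebra_simps)
    finally show ?thesis by (simp only: evid_def)
  qed
  then have "(\<Sum>y\<in>UNIV. P y * entropy N (\<pi>' y)) =
      (\<Sum>y\<in>UNIV. \<Sum>i\<in>{1..N}. - (\<pi> i * ln (\<pi> i)) * L y i - \<pi> i * (L y i * ln (L y i)))
      + (\<Sum>y\<in>UNIV. P y * ln (P y))"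
    by (simp only: sum.distrib)
  also have "\<dots> = (\<Sum>i\<in>{1..N}. - (\<pi> i * ln (\<pi> i)) * (\<Sum>y\<in>UNIV. L y i)
      - \<pi> i * (\<Sum>y\<in>UNIV. L y i * ln (L y i))) - binent (P True)"
    by (subst sum.swap) (simp add: sum_subtractf sum_negf sum_distrib_left evid_ln)
  also have "\<dots> = entropy N \<pi> - (binent (P True) - binent q)"
    by (simp add: sum_lik lik_ln entropy_def sum_subtractf sum_negf pi_sum flip: sum_distrib_right)
  finally show ?thesis .
qed

text \<open>\<open>P True\<close> lies in \<open>[q, 1 - q]\<close>, where the binary entropy is
  smallest at the ends.\<close>

lemma binent_evid_ge: "binent q \<le> binent (P True)"
proof (cases "P True \<le> 1/2")
  case True
  then show ?thesis using q0 evid_bounds by (intro binent_mono) auto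
next
  case False
  then have "binent q \<le> binent (1 - P True)"
    using q0 evid_bounds[of True] by (intro binent_mono) auto
  then show ?thesis by (simp add: binent_minus)
qed

text \<open>Index \<open>i\<close> contributes \<open>sqrt (\<pi> i)\<close> times the Bhattacharyya
  coefficient of its likelihood and the predictive law, so a gap at every index shrinks the sum by a
  constant factor.\<close>

lemma sqrt_sum_drift:
  assumes c: "\<And>i. i \<in> {1..N} \<Longrightarrow> c \<le> (L True i - P True)\<^sup>2 / 4"
  shows "(\<Sum>y\<in>UNIV. P y * sqrt_sum N (\<pi>' y)) \<le> (1 - c) * sqrt_sum N \<pi>"
proof -
  have "(\<Sum>y\<in>UNIV. P y * sqrt_sum N (\<pi>' y)) = (\<Sum>y\<in>UNIV. \<Sum>i\<in>{1..N}. sqrt (\<pi> i) * sqrt (L y i * P y))"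
    unfolding sqrt_sum_def sum_distrib_left
  proof (intro sum.cong refl)
    fix y i assume "i \<in> {1..N}"
    have "P y * sqrt (\<pi>' y i) = sqrt (P y * P y * (\<pi> i * L y i / P y))"
      using evid_pos[of y] unfolding bayes_update_lik real_sqrt_mult[of "P y * P y"] by simp
    also have "P y * P y * (\<pi> i * L y i / P y) = \<pi> i * (L y i * P y)"
      using evid_pos[of y] by simp
    finally show "P y * sqrt (\<pi>' y i) = sqrt (\<pi> i) * sqrt (L y i * P y)" by (simp add: real_sqrt_mult)
  qed
  also have "\<dots> = (\<Sum>i\<in>{1..N}. sqrt (\<pi> i) * (\<Sum>y\<in>UNIV. sqrt (L y i * P y)))"
    by (subst sum.swap) (simp only: sum_distrib_left)
  also have "\<dots> \<le> (\<Sum>i\<in>{1..N}. sqrt (\<pi> i) * (1 - c))"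
  proof (intro sum_mono mult_left_mono)
    fix i assume i: "i \<in> {1..N}"
    have F: "L False i = 1 - L True i" "P False = 1 - P True"
      using sum_lik[of S q i] sum_evid by (auto simp: UNIV_bool)
    have "(\<Sum>y\<in>UNIV. sqrt (L y i * P y)) \<le> 1 - (L True i - P True)\<^sup>2 / 4"
      using bhattacharyya[of "L True i" "P True"] lik_bounds[of q S True i] evid_bounds[of True] q0 q1
      by (simp add: UNIV_bool F)
    then show "(\<Sum>y\<in>UNIV. sqrt (L y i * P y)) \<le> 1 - c" using c[OF i] by simp
  qed (use pi_pos in \<open>auto simp: less_imp_le\<close>)
  finally show ?thesis by (simp add: sqrt_sum_def sum_distrib_left mult.commute)
qed

text \<open>The expected growth factor of \<open>(\<pi> i)\<^sup>2\<close> is 1 plus the chi-square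
  distance of the likelihood of \<open>i\<close> from the predictive law. No index loses, and only
  the gain at \<open>m\<close> is kept.\<close>

lemma square_sum_drift:
  assumes "m \<in> {1..N}"
  shows "square_sum N \<pi> + 2 * ((\<pi> m)\<^sup>2 * (L True m - P True)\<^sup>2) \<le> (\<Sum>y\<in>UNIV. P y * square_sum N (\<pi>' y))"
proof -
  have "(\<Sum>y\<in>UNIV. P y * square_sum N (\<pi>' y)) = (\<Sum>i\<in>{1..N}. (\<pi> i)\<^sup>2 * (\<Sum>y\<in>UNIV. (L y i)\<^sup>2 / P y))"
    unfolding square_sum_def sum_distrib_left
  proof (subst sum.swap, intro sum.cong refl)
    fix y i
    have "P y * (\<pi>' y i)\<^sup>2 = P y * ((\<pi> i)\<^sup>2 * (L y i)\<^sup>2 / (P y * P y))"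
      by (simp only: bayes_update_lik power_mult_distrib power_divide power2_eq_square[of "P y"])
    then show "P y * (\<pi>' y i)\<^sup>2 = (\<pi> i)\<^sup>2 * ((L y i)\<^sup>2 / P y)"
      using evid_pos[of y] by simp
  qed
  moreover have "(\<pi> i)\<^sup>2 * (1 + 2 * (L True i - P True)\<^sup>2) \<le> (\<pi> i)\<^sup>2 * (\<Sum>y\<in>UNIV. (L y i)\<^sup>2 / P y)" for i
  proof (intro mult_left_mono)
    \<comment> \<open>\<open>2 L - P\<close> is the tangent of \<open>L\<^sup>2 / P\<close> at
      \<open>L = P\<close>; the remainder \<open>(L - P)\<^sup>2 / P\<close> is weakened with
      \<open>P < 1\<close>.\<close>
    have *: "2 * L y i - P y + (L y i - P y)\<^sup>2 \<le> (L y i)\<^sup>2 / P y" for y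
    proof -
      have "(L y i - P y)\<^sup>2 * P y \<le> (L y i - P y)\<^sup>2"
        using evid_lt1[of y] by (intro mult_left_le) (auto simp: less_imp_le)
      then have "(2 * L y i - P y + (L y i - P y)\<^sup>2) * P y \<le> (L y i)\<^sup>2"
        by (simp add: power2_eq_square algebra_simps)
      then show ?thesis using evid_pos[of y] by (simp add: pos_le_divide_eq)
    qed
    have "(\<Sum>y\<in>UNIV. 2 * L y i - P y + (L y i - P y)\<^sup>2) = 1 + 2 * (L True i - P True)\<^sup>2"
    proof -
      have F: "L False i = 1 - L True i" "P False = 1 - P True"
        using sum_lik[of S q i] sum_evid by (auto simp: UNIV_bool)
      show ?thesis unfolding UNIV_bool by (simp add: F) (simp add: power2_eq_square algebra_simps)
    qed
    then show "1 + 2 * (L True i - P True)\<^sup>2 \<le> (\<Sum>y\<in>UNIV. (L y i)\<^sup>2 / P y)"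
      using sum_mono[of UNIV, OF *] by (rule ord_eq_le_trans[OF sym])
  qed auto
  ultimately have "(\<Sum>i\<in>{1..N}. (\<pi> i)\<^sup>2 * (1 + 2 * (L True i - P True)\<^sup>2)) \<le> (\<Sum>y\<in>UNIV. P y * square_sum N (\<pi>' y))"
    by (simp only: sum_mono)
  moreover have "(\<pi> m)\<^sup>2 * (L True m - P True)\<^sup>2 \<le> (\<Sum>i\<in>{1..N}. (\<pi> i)\<^sup>2 * (L True i - P True)\<^sup>2)"
    using assms by (intro member_le_sum) auto
  moreover have "(\<Sum>i\<in>{1..N}. (\<pi> i)\<^sup>2 * (1 + 2 * (L True i - P True)\<^sup>2)) =
      square_sum N \<pi> + 2 * (\<Sum>i\<in>{1..N}. (\<pi> i)\<^sup>2 * (L True i - P True)\<^sup>2)"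
    unfolding square_sum_def sum_distrib_left sum.distrib[symmetric]
    by (intro sum.cong refl) (simp add: distrib_left)
  ultimately show ?thesis by linarith
qed

lemma one_minus_update:
  "1 - \<pi>' y i = (P y - \<pi> i * L y i) / P y"
  using evid_pos[of y] by (simp add: bayes_update_lik diff_divide_distrib)

lemma evid_minus_ge:
  assumes "i \<in> {1..N}" shows "(1 - \<pi> i) * q \<le> P y - \<pi> i * L y i"
proof -
  have "P y - \<pi> i * L y i = (\<Sum>j\<in>{1..N} - {i}. \<pi> j * L y j)"
    unfolding evid_def using assms by (simp add: sum.remove)
  moreover have "(\<Sum>j\<in>{1..N} - {i}. \<pi> j * q) \<le> (\<Sum>j\<in>{1..N} - {i}. \<pi> j * L y j)"
    using lik_bounds[of q] q1 pi_pos by (intro sum_mono mult_left_mono) (auto simp: less_imp_le)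
  moreover have "(\<Sum>j\<in>{1..N} - {i}. \<pi> j) = 1 - \<pi> i"
    using assms pi_sum by (simp add: sum_diff1)
  ultimately show ?thesis by (simp flip: sum_distrib_right)
qed

text \<open>One update shrinks \<open>1 - \<pi> i\<close> at most by the factor \<open>q\<close>,
  which limits the overshoot at the stopping time.\<close>

lemma one_minus_update_ge:
  assumes "i \<in> {1..N}" shows "(1 - \<pi> i) * q \<le> 1 - \<pi>' y i"
proof -
  have "(1 - \<pi> i) * q \<le> P y - \<pi> i * L y i" by (rule evid_minus_ge[OF assms])
  also have "\<dots> \<le> (P y - \<pi> i * L y i) / P y"
  proof -
    have "0 \<le> P y - \<pi> i * L y i"
      using evid_minus_ge[OF assms, of y] pi_le_1[OF assms] q0
      by (meson diff_ge_0_iff_ge less_imp_le mult_nonneg_nonneg order_trans)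
    then show ?thesis
      using evid_pos[of y] evid_lt1[of y] by (simp add: pos_le_divide_eq mult_left_le)
  qed
  finally show ?thesis by (simp add: one_minus_update)
qed

text \<open>The law of the next observation given that the target is not \<open>i\<close>.\<close>

definition others_evid :: "nat \<Rightarrow> bool \<Rightarrow> real" where
  "others_evid i y = (P y - \<pi> i * L y i) / (1 - \<pi> i)"

text \<open>Since \<open>1 - \<pi>' y i\<close> is
  \<open>(1 - \<pi> i) * others_evid i y / P y\<close>, the increment is the divergence of the
  predictive law from \<open>others_evid i\<close>. The other two claims make the latter a
  probability law.\<close>

lemma log_term_drift:
  assumes "i \<in> {1..N}" "\<pi> i < 1"
  shows "(\<Sum>y\<in>UNIV. P y * - ln (1 - \<pi>' y i)) =
    - ln (1 - \<pi> i) + ((\<Sum>y\<in>UNIV. P y * ln (P y)) - (\<Sum>y\<in>UNIV. P y * ln (others_evid i y)))"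
    and "0 < others_evid i y" and "(\<Sum>y\<in>UNIV. others_evid i y) = 1"
proof -
  have pos: "0 < P y - \<pi> i * L y i" for y
  proof -
    have "0 < (1 - \<pi> i) * q" using assms q0 by simp
    then show ?thesis using evid_minus_ge[OF assms(1), of y] by linarith
  qed
  show "0 < others_evid i y" using pos[of y] assms by (simp add: others_evid_def)
  have "(\<Sum>y\<in>UNIV. P y - \<pi> i * L y i) = 1 - \<pi> i"
    by (simp add: sum_subtractf sum_evid sum_lik flip: sum_distrib_left)
  then show "(\<Sum>y\<in>UNIV. others_evid i y) = 1"
    using assms by (simp add: others_evid_def flip: sum_divide_distrib)
  have "P y * - ln (1 - \<pi>' y i) = P y * - ln (1 - \<pi> i) + P y * ln (P y) - P y * ln (others_evid i y)" for y
    using pos[of y] evid_pos[of y] assms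
    by (simp add: one_minus_update others_evid_def ln_div algebra_simps)
  then show "(\<Sum>y\<in>UNIV. P y * - ln (1 - \<pi>' y i)) =
    - ln (1 - \<pi> i) + ((\<Sum>y\<in>UNIV. P y * ln (P y)) - (\<Sum>y\<in>UNIV. P y * ln (others_evid i y)))"
    by (simp only: sum_subtractf sum.distrib sum_distrib_right[symmetric] sum_evid)
qed

lemma log_term_nondecreasing:
  assumes "i \<in> {1..N}" "\<pi> i < 1"
  shows "- ln (1 - \<pi> i) \<le> (\<Sum>y\<in>UNIV. P y * - ln (1 - \<pi>' y i))"
  using gibbs_bool[of P "others_evid i"] log_term_drift[OF assms] evid_pos sum_evid by simp

lemma log_sum_nondecreasing:
  assumes "\<And>i. i \<in> {1..N} \<Longrightarrow> \<pi> i < 1"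
  shows "log_sum N \<pi> \<le> (\<Sum>y\<in>UNIV. P y * log_sum N (\<pi>' y))"
proof -
  have "log_sum N \<pi> \<le> (\<Sum>i\<in>{1..N}. \<Sum>y\<in>UNIV. P y * - ln (1 - \<pi>' y i))"
    unfolding log_sum_def using assms by (intro sum_mono log_term_nondecreasing)
  then show ?thesis unfolding log_sum_def sum_distrib_left by (subst sum.swap)
qed

text \<open>By Gibbs' inequality \<open>D(P \<parallel> L\<^sub>0) \<ge> E\<^sub>P ln (L\<^sub>1 / L\<^sub>0)\<close>, and the right-hand side is
  \<open>(2 \<pi>\<^sub>m - 1) C\<^sub>1(q)\<close>, uniformly in \<open>q\<close>.\<close>

lemma log_sum_drift:
  assumes lt1: "\<And>i. i \<in> {1..N} \<Longrightarrow> \<pi> i < 1" and m: "S = {m}"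
  shows "log_sum N \<pi> + (2 * \<pi> m - 1) * ((1 - 2 * q) * ln ((1 - q) / q))
    \<le> (\<Sum>y\<in>UNIV. P y * log_sum N (\<pi>' y))"
proof -
  have mN: "m \<in> {1..N}" using S m by auto
  \<comment> \<open>\<open>l True\<close> and \<open>l False\<close> are the laws of the observation
    for \<open>\<theta> = m\<close> and for \<open>\<theta> \<noteq> m\<close>.\<close>
  define l where "l b y = (if y = b then 1 - q else q)" for b y :: bool
  have other: "others_evid m y = l False y" for y
  proof -
    have "P y - \<pi> m * L y m = (\<Sum>j\<in>{1..N} - {m}. \<pi> j * L y j)"
      unfolding evid_def using mN by (simp add: sum.remove)
    also have "\<dots> = (\<Sum>j\<in>{1..N} - {m}. \<pi> j * l False y)"
      by (intro sum.cong) (auto simp: lik_def l_def m)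
    also have "\<dots> = (1 - \<pi> m) * l False y"
      using mN pi_sum by (simp add: sum_diff1 flip: sum_distrib_right)
    finally show ?thesis using lt1[OF mN] by (simp add: others_evid_def)
  qed
  have "(\<Sum>y\<in>UNIV. P y * ln (l True y)) \<le> (\<Sum>y\<in>UNIV. P y * ln (P y))"
    using evid_pos sum_evid q0 q1 by (intro gibbs_bool) (auto simp: l_def UNIV_bool)
  moreover have "(\<Sum>y\<in>UNIV. P y * ln (l True y)) - (\<Sum>y\<in>UNIV. P y * ln (l False y)) =
      (2 * \<pi> m - 1) * ((1 - 2 * q) * ln ((1 - q) / q))"
  proof -
    have F: "P False = 1 - P True" using sum_evid by (simp add: UNIV_bool)
    show ?thesis using q0 q1
      by (simp add: UNIV_bool l_def F evid_True ln_div) (simp add: m algebra_simps)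
  qed
  ultimately have m_term: "- ln (1 - \<pi> m) + (2 * \<pi> m - 1) * ((1 - 2 * q) * ln ((1 - q) / q))
      \<le> (\<Sum>y\<in>UNIV. P y * - ln (1 - \<pi>' y m))"
    using log_term_drift(1)[OF mN lt1[OF mN]] unfolding other by linarith
  have "log_sum N \<pi> + (2 * \<pi> m - 1) * ((1 - 2 * q) * ln ((1 - q) / q))
      = (- ln (1 - \<pi> m) + (2 * \<pi> m - 1) * ((1 - 2 * q) * ln ((1 - q) / q)))
        + (\<Sum>i\<in>{1..N} - {m}. - ln (1 - \<pi> i))"
    unfolding log_sum_def using mN by (simp add: sum.remove)
  also have "\<dots> \<le> (\<Sum>y\<in>UNIV. P y * - ln (1 - \<pi>' y m))
      + (\<Sum>i\<in>{1..N} - {m}. \<Sum>y\<in>UNIV. P y * - ln (1 - \<pi>' y i))"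
    using m_term lt1 by (intro add_mono sum_mono log_term_nondecreasing) auto
  also have "\<dots> = (\<Sum>i\<in>{1..N}. \<Sum>y\<in>UNIV. P y * - ln (1 - \<pi>' y i))"
    using mN by (intro sum.remove[symmetric]) auto
  also have "\<dots> = (\<Sum>y\<in>UNIV. P y * log_sum N (\<pi>' y))"
    unfolding log_sum_def sum_distrib_left by (rule sum.swap)
  finally show ?thesis .
qed

end

section \<open>The combined potential\<close>

lemma entropy_nonneg: assumes "posterior N \<pi>" shows "0 \<le> entropy N \<pi>"
  unfolding entropy_def
proof (rule sum_nonneg)
  fix i assume "i \<in> {1..N}"
  then show "0 \<le> - (\<pi> i * ln (\<pi> i))"
    using posterior_pos[OF assms, of i] posterior_le_1[OF assms, of i] by (auto simp: mult_le_0_iff)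
qed

lemma sqrt_sum_nonneg: assumes "posterior N \<pi>" shows "0 \<le> sqrt_sum N \<pi>"
  unfolding sqrt_sum_def using assms by (intro sum_nonneg) (auto simp: posterior_def less_imp_le)

lemma square_sum_nonneg: "0 \<le> square_sum N \<pi>"
  by (simp add: square_sum_def sum_nonneg)

lemma square_sum_le_1: assumes "posterior N \<pi>" shows "square_sum N \<pi> \<le> 1"
proof -
  have "square_sum N \<pi> \<le> (\<Sum>i\<in>{1..N}. \<pi> i)"
    unfolding square_sum_def power2_eq_square using posterior_pos[OF assms] posterior_le_1[OF assms]
    by (intro sum_mono mult_left_le) (auto simp: less_imp_le)
  then show ?thesis using posterior_sum[OF assms] by simp
qed

text \<open>The largest entry costs at most \<open>ln (1 / d)\<close>. Every other entry is at most
  1/2 and so costs at most \<open>2 * \<pi> i\<close>.\<close>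

lemma log_sum_le:
  assumes "1 \<le> N" "posterior N \<pi>" "0 < d" "\<And>i. i \<in> {1..N} \<Longrightarrow> d \<le> 1 - \<pi> i"
  shows "log_sum N \<pi> \<le> ln (1 / d) + 2"
proof -
  note pos = posterior_pos[OF assms(2)] and sum1 = posterior_sum[OF assms(2)]
  obtain m where m: "m \<in> {1..N}" "\<pi> m = max_post N \<pi>"
    using max_in_sortPM[OF assms(1,2)] sortPM_subset[OF assms(1,2)] by blast
  have rest: "(\<Sum>i\<in>{1..N} - {m}. \<pi> i) = 1 - \<pi> m"
    using m sum1 by (simp add: sum_diff1)
  have "- ln (1 - \<pi> i) \<le> 2 * \<pi> i" if i: "i \<in> {1..N} - {m}" for i
  proof -
    have "\<pi> i \<le> (\<Sum>i\<in>{1..N} - {m}. \<pi> i)"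
      using i pos by (intro member_le_sum) (auto simp: less_imp_le)
    moreover have "\<pi> i \<le> \<pi> m" using i m le_max_post[OF assms(1,2)] by simp
    ultimately have half: "\<pi> i \<le> 1/2" using rest by simp
    have "- ln (1 - \<pi> i) = ln (1 / (1 - \<pi> i))" using half by (simp add: ln_div)
    also have "\<dots> \<le> 1 / (1 - \<pi> i) - 1" using half by (intro ln_le_minus_one) auto
    also have "\<dots> = \<pi> i / (1 - \<pi> i)" using half by (simp add: field_simps)
    also have "\<dots> \<le> \<pi> i / (1 / 2)" using half pos[of i] i by (intro divide_left_mono) auto
    finally show ?thesis by simp
  qed
  then have "(\<Sum>i\<in>{1..N} - {m}. - ln (1 - \<pi> i)) \<le> (\<Sum>i\<in>{1..N} - {m}. 2 * \<pi> i)" by (rule sum_mono)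
  also have "\<dots> = 2 * (1 - \<pi> m)" by (simp only: rest sum_distrib_left[symmetric])
  also have "\<dots> \<le> 2" using pos[of m] m by simp
  finally have "(\<Sum>i\<in>{1..N} - {m}. - ln (1 - \<pi> i)) \<le> 2" .
  moreover have "ln d \<le> ln (1 - \<pi> m)" using assms(3) assms(4)[OF m(1)] by simp
  then have "- ln (1 - \<pi> m) \<le> ln (1 / d)" using assms(3) by (simp add: ln_div)
  moreover have "log_sum N \<pi> = - ln (1 - \<pi> m) + (\<Sum>i\<in>{1..N} - {m}. - ln (1 - \<pi> i))"
    unfolding log_sum_def using m by (intro sum.remove) auto
  ultimately show ?thesis by linarith
qed

section \<open>The constants \<open>C1\<close> and \<open>I_bsc\<close> in closed form\<close>

lemma C1_eq:
  assumes "0 < q" "q < 1" shows "C1 q = (1 - 2 * q) * ln ((1 - q) / q)"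
  using assms by (simp add: C1_def KL_def UNIV_bool ln_div algebra_simps)

lemma C1_mono:
  assumes "0 < q" "q \<le> r" "r < 1/2" shows "C1 r \<le> C1 q"
proof -
  have "(1 - r) / r \<le> (1 - q) / q" using assms by (simp add: field_simps)
  then have "ln ((1 - r) / r) \<le> ln ((1 - q) / q)" using assms by simp
  moreover have "0 \<le> ln ((1 - r) / r)" using assms by (simp add: field_simps)
  ultimately show ?thesis using assms by (simp add: C1_eq mult_mono)
qed

lemma C1_pos: "0 < q \<Longrightarrow> q < 1/2 \<Longrightarrow> 0 < C1 q"
  by (simp add: C1_eq field_simps)

text \<open>The overshoot allowance contains \<open>ln (1 / q)\<close> with
  \<open>q = p (1 / real N)\<close>, which may be unbounded in \<open>N\<close>. This comparison
  keeps its quotient by \<open>C1 q\<close> bounded.\<close>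

lemma ln_inverse_le_C1:
  assumes "0 < q" "q \<le> r" "r < 1/2"
  shows "ln (1 / q) \<le> C1 q * (1 / (1 - 2 * r)) + ln 2"
proof -
  have "ln (1 / q) = ln ((1 - q) / q) + ln (1 / (1 - q))" using assms by (simp add: ln_div)
  moreover have "ln (1 / (1 - q)) \<le> ln 2" using assms by (subst ln_le_cancel_iff) (auto simp: field_simps)
  moreover have "ln ((1 - q) / q) \<le> C1 q * (1 / (1 - 2 * r))"
  proof -
    have l: "0 \<le> ln ((1 - q) / q)" using assms by (simp add: field_simps)
    have "ln ((1 - q) / q) * (1 - 2 * r) \<le> ln ((1 - q) / q) * (1 - 2 * q)"
      using l assms by (intro mult_left_mono) auto
    then show ?thesis using assms by (simp add: C1_eq pos_le_divide_eq mult.commute)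
  qed
  ultimately show ?thesis by linarith
qed

lemma pmf_bsc_joint:
  assumes "0 \<le> x" "x \<le> 1" "0 \<le> q" "q \<le> 1"
  shows "pmf (bsc_joint x q) (a, b) = (if a then x else 1 - x) * (if a \<noteq> b then q else 1 - q)"
  using assms by (simp add: bsc_joint_def map_pmf_def pmf_bind)

text \<open>A uniform input gives a uniform output, of entropy \<open>ln 2\<close>, and the noise
  has entropy \<open>binent q\<close>.\<close>

lemma I_bsc_half:
  assumes "0 < q" "q < 1" shows "I_bsc (1/2) q = ln 2 - binent q"
proof -
  have fst: "map_pmf fst (bsc_joint (1/2) q) = bernoulli_pmf (1/2)"
    by (simp add: bsc_joint_def map_bind_pmf map_pmf_comp bind_return_pmf')
  have snd: "pmf (map_pmf snd (bsc_joint (1/2) q)) b = 1/2" for b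
    using assms by (cases b) (simp_all add: bsc_joint_def map_pmf_def bind_assoc_pmf bind_return_pmf pmf_bind field_simps)
  have ln: "ln ((4 - q * 4) / 2) = ln 2 + ln (1 - q)"
  proof -
    have "(4 - q * 4) / 2 = 2 * (1 - q)" by simp
    then show ?thesis using assms by (simp only: ln_mult_pos)
  qed
  show ?thesis
    unfolding I_bsc_def mutual_info_def UNIV_Times_UNIV[symmetric] UNIV_bool
    using assms by (simp add: fst snd pmf_bsc_joint binent_def ln_mult algebra_simps)
      (simp add: ln algebra_simps)
qed

text \<open>\<open>square_sum\<close> and \<open>log_sum\<close> are submartingales and therefore
  enter with a minus sign. Dividing by \<open>sqrt N\<close> normalizes the second summand to
  \<open>b\<close> at the uniform prior.\<close>

definition potential :: "real \<Rightarrow> real \<Rightarrow> real \<Rightarrow> real \<Rightarrow> real \<Rightarrow> nat \<Rightarrow> (nat \<Rightarrow> real) \<Rightarrow> real" where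
  "potential a b c d l N \<pi> = a * entropy N \<pi> + b * (sqrt_sum N \<pi> / sqrt N)
     + c * (1 - square_sum N \<pi>) + d * (l - log_sum N \<pi>)"

text \<open>The gains \<open>s\<close> and \<open>D\<close> are parameters: each case of the later
  analysis supplies the one that it can prove and sets the rest to 0.\<close>

lemma potential_drift:
  assumes step: "posterior N \<pi>" "S \<subseteq> {1..N}" "0 < q" "q < 1/2"
    and coeff: "0 \<le> a" "0 \<le> b" "0 \<le> c" "0 \<le> d"
    and m: "m \<in> {1..N}"
    and s: "\<And>i. i \<in> {1..N} \<Longrightarrow> s \<le> (lik S q True i - evid N \<pi> S q True)\<^sup>2 / 4"
    and D: "log_sum N \<pi> + D \<le> (\<Sum>y\<in>UNIV. evid N \<pi> S q y * log_sum N (bayes_update N \<pi> S q y))"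
  shows "(\<Sum>y\<in>UNIV. evid N \<pi> S q y * potential a b c d l N (bayes_update N \<pi> S q y)) \<le>
    potential a b c d l N \<pi> - (a * (binent (evid N \<pi> S q True) - binent q)
      + b * (s * (sqrt_sum N \<pi> / sqrt N))
      + c * (2 * ((\<pi> m)\<^sup>2 * (lik S q True m - evid N \<pi> S q True)\<^sup>2)) + d * D)"
proof -
  let ?E = "\<lambda>f. \<Sum>y\<in>UNIV. evid N \<pi> S q y * f N (bayes_update N \<pi> S q y)"
  have "?E (potential a b c d l) = a * ?E entropy + b * (?E sqrt_sum / sqrt N)
      + c * ((\<Sum>y\<in>UNIV. evid N \<pi> S q y) - ?E square_sum)
      + d * (l * (\<Sum>y\<in>UNIV. evid N \<pi> S q y) - ?E log_sum)"
    by (simp add: potential_def UNIV_bool add_divide_distrib algebra_simps)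
  also have "\<dots> = a * ?E entropy + b * (?E sqrt_sum / sqrt N) + c * (1 - ?E square_sum) + d * (l - ?E log_sum)"
    by (simp add: sum_evid[OF step])
  also have "\<dots> \<le> a * (entropy N \<pi> - (binent (evid N \<pi> S q True) - binent q))
      + b * ((1 - s) * sqrt_sum N \<pi> / sqrt N)
      + c * (1 - (square_sum N \<pi> + 2 * ((\<pi> m)\<^sup>2 * (lik S q True m - evid N \<pi> S q True)\<^sup>2)))
      + d * (l - (log_sum N \<pi> + D))"
    using coeff D square_sum_drift[OF step m] entropy_drift[OF step] sqrt_sum_drift[OF step s]
    by (intro add_mono mult_left_mono divide_right_mono diff_left_mono) auto
  also have "\<dots> = potential a b c d l N \<pi> - (a * (binent (evid N \<pi> S q True) - binent q)
      + b * (s * (sqrt_sum N \<pi> / sqrt N))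
      + c * (2 * ((\<pi> m)\<^sup>2 * (lik S q True m - evid N \<pi> S q True)\<^sup>2)) + d * D)"
    by (simp add: potential_def diff_divide_distrib algebra_simps)
  finally show ?thesis .
qed

text \<open>Entries outside the query are at most \<open>1 / (\<alpha> * N)\<close>, so
  \<open>sqrt (\<pi> j)\<close> is at least \<open>\<pi> j * sqrt (\<alpha> * N)\<close>; together
  they carry mass at least 1/4.\<close>

lemma sqrt_sum_ge:
  fixes \<alpha> :: real
  assumes N: "1 \<le> N" and post: "posterior N \<pi>" and "0 < \<alpha>" and large: "\<alpha> * N \<le> card (sortPM N \<pi>)"
    and \<sigma>: "(\<Sum>i\<in>sortPM N \<pi>. \<pi> i) \<le> 3/4"
  shows "sqrt \<alpha> / 4 \<le> sqrt_sum N \<pi> / sqrt N"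
proof -
  let ?S = "sortPM N \<pi>"
  have \<alpha>N: "0 < \<alpha> * N" using assms by simp
  have "\<pi> j * sqrt (\<alpha> * N) \<le> sqrt (\<pi> j)" if j: "j \<in> {1..N} - ?S" for j
  proof -
    have pos: "0 < \<pi> j" using j posterior_pos[OF post] by simp
    have "\<pi> j * (\<alpha> * N) \<le> \<pi> j * card ?S" using large pos by (intro mult_left_mono) auto
    also have "\<dots> \<le> 1" using outside_sortPM_le[OF N post j] \<sigma> by simp
    finally have "sqrt (\<pi> j * (\<alpha> * N)) \<le> 1" by simp
    then have "sqrt (\<pi> j) * sqrt (\<pi> j * (\<alpha> * N)) \<le> sqrt (\<pi> j)" using pos by (intro mult_left_le) auto
    then show ?thesis using pos by (simp add: real_sqrt_mult flip: mult.assoc)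
  qed
  then have "(\<Sum>j\<in>{1..N} - ?S. \<pi> j * sqrt (\<alpha> * N)) \<le> (\<Sum>j\<in>{1..N} - ?S. sqrt (\<pi> j))" by (rule sum_mono)
  also have "\<dots> \<le> sqrt_sum N \<pi>"
    unfolding sqrt_sum_def using posterior_pos[OF post] by (intro sum_mono2) (auto simp: less_imp_le)
  finally have "(\<Sum>j\<in>{1..N} - ?S. \<pi> j) * sqrt (\<alpha> * N) \<le> sqrt_sum N \<pi>" by (simp add: sum_distrib_right)
  moreover have "1/4 \<le> (\<Sum>j\<in>{1..N} - ?S. \<pi> j)"
    using sortPM_subset[OF N post] \<sigma> posterior_sum[OF post] by (simp add: sum_diff)
  then have "1/4 * sqrt (\<alpha> * N) \<le> (\<Sum>j\<in>{1..N} - ?S. \<pi> j) * sqrt (\<alpha> * N)"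
    using \<alpha>N by (intro mult_right_mono) auto
  ultimately have "1/4 * sqrt (\<alpha> * N) \<le> sqrt_sum N \<pi>" by linarith
  then show ?thesis using N by (simp add: pos_le_divide_eq real_sqrt_mult)
qed

text \<open>The invariant that serves as \<open>G\<close> in \<open>lyapunov_bound\<close>; the
  margin \<open>d\<close> keeps \<open>log_sum\<close> bounded.\<close>

definition nondegenerate :: "nat \<Rightarrow> real \<Rightarrow> (nat \<Rightarrow> real) \<Rightarrow> bool" where
  "nondegenerate N d \<pi> \<longleftrightarrow> posterior N \<pi> \<and> (\<forall>i\<in>{1..N}. d \<le> 1 - \<pi> i)"

lemma mult_inverse_ge_1:
  fixes x y :: real assumes "0 < x" "x \<le> y" shows "1 \<le> 1 / x * y"
  using assms by (simp add: field_simps)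

section \<open>The Lyapunov function and its drift\<close>

context
  fixes p :: "real \<Rightarrow> real" and \<alpha> e \<rho> \<epsilon> :: real and N :: nat
  assumes p_range: "\<forall>x\<in>{0<..<1}. 0 < p x \<and> p x < 1/2"
    and p_mono: "mono_on {0<..<1} p"
    and \<alpha>: "0 < \<alpha>" "\<alpha> < 1" and e: "0 < e" "e < 1"
    and \<rho>: "0 < \<rho>" "\<rho> \<le> 1/4" "2 * \<rho> \<le> e" "\<rho>\<^sup>2 \<le> e * (ln 2 - binent (p \<alpha>))"
    and N: "2 \<le> N" and \<epsilon>: "0 < \<epsilon>" "\<epsilon> < 1"
begin

private abbreviation (input) "p_half \<equiv> p (1/2)"
private abbreviation (input) "p_single \<equiv> p (1 / real N)"
private abbreviation (input) "rate \<equiv> ln 2 - binent (p \<alpha>)"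

text \<open>The summands pay, in this order, for the steps at which the largest posterior entry is below
  \<open>\<rho>\<close> and the query is small, below \<open>\<rho>\<close> and the query is large, between \<open>\<rho>\<close> and \<open>1 - \<rho>\<close>, and
  above \<open>1 - \<rho>\<close>. The offset in the last one bounds \<^const>\<open>log_sum\<close> on all reachable states,
  overshoot at the stopping time included.\<close>

definition lyapunov :: "(nat \<Rightarrow> real) \<Rightarrow> real" where
  "lyapunov = potential (1 / ((1 - e) * rate)) (1 / ((1 - 2 * p_half)\<^sup>2 / 64 * (sqrt \<alpha> / 4)))
    (1 / (2 * (\<rho>\<^sup>2 * (\<rho> * (1 - 2 * p_half))\<^sup>2))) (1 / ((1 - e) * C1 p_single)) (ln (1 / (\<epsilon> * p_single)) + 2) N"

lemma p_half: "0 < p_half" "p_half < 1/2"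
  using p_range by auto

lemma p_le: "0 < x \<Longrightarrow> x \<le> y \<Longrightarrow> y < 1 \<Longrightarrow> p x \<le> p y"
  using p_mono by (auto simp: mono_on_def)

lemma p_single: "0 < p_single" "p_single \<le> p_half" "p_single < 1/2"
  using p_half N p_range p_le[of "1 / real N" "1/2"] by auto

lemma rate_pos: "0 < rate"
  using binent_less_ln2[of "p \<alpha>"] p_range \<alpha> by simp

lemma noise_bounds:
  assumes "posterior N \<pi>"
  shows "p_single \<le> noise p N \<pi>" "noise p N \<pi> \<le> p_half" "0 < noise p N \<pi>" "noise p N \<pi> < 1/2"
proof -
  have "1 \<le> N" using N by simp
  have c: "1 \<le> card (sortPM N \<pi>)" "2 * card (sortPM N \<pi>) \<le> N"
    using card_sortPM_le_half[OF \<open>1 \<le> N\<close> assms N] card_sortPM[OF \<open>1 \<le> N\<close> assms]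
      kstar_in[OF \<open>1 \<le> N\<close> assms] by auto
  have "real (2 * card (sortPM N \<pi>)) \<le> real N" using c(2) by (rule of_nat_mono)
  then have "1 / real N \<le> card (sortPM N \<pi>) / real N" "card (sortPM N \<pi>) / real N \<le> 1/2"
    using c(1) N by (auto simp: field_simps)
  then show "p_single \<le> noise p N \<pi>" "noise p N \<pi> \<le> p_half"
    using N c(1) unfolding noise_def by (intro p_le; simp)+
  then show "0 < noise p N \<pi>" "noise p N \<pi> < 1/2" using p_single p_half by auto
qed

lemma lyapunov_coeff_pos: "0 < 1 / ((1 - e) * rate)" "0 < 1 / ((1 - 2 * p_half)\<^sup>2 / 64 * (sqrt \<alpha> / 4))"
  "0 < 1 / (2 * (\<rho>\<^sup>2 * (\<rho> * (1 - 2 * p_half))\<^sup>2))" "0 < 1 / ((1 - e) * C1 p_single)"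
  using rate_pos e p_half \<alpha> \<rho> C1_pos[OF p_single(1,3)] by simp_all

lemma lyapunov_nonneg:
  assumes "nondegenerate N (\<epsilon> * p_single) \<pi>" shows "0 \<le> lyapunov \<pi>"
proof -
  have post: "posterior N \<pi>" using assms by (simp add: nondegenerate_def)
  have "log_sum N \<pi> \<le> ln (1 / (\<epsilon> * p_single)) + 2"
    using assms N \<epsilon> p_single by (intro log_sum_le) (auto simp: nondegenerate_def)
  then show ?thesis
    unfolding lyapunov_def potential_def
    using entropy_nonneg[OF post] sqrt_sum_nonneg[OF post] square_sum_le_1[OF post]
    by (intro add_nonneg_nonneg mult_nonneg_nonneg lyapunov_coeff_pos[THEN less_imp_le]) auto
qed

text \<open>While the search runs, \<open>1 - \<pi> i \<ge> \<epsilon>\<close>, and one update costs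
  at most the factor \<open>noise p N \<pi> \<ge> p_single\<close>. The new margin is independent of
  \<open>d\<close>, so it does not deteriorate over time.\<close>

lemma nondegenerate_update:
  assumes "nondegenerate N d \<pi>" "max_post N \<pi> \<le> 1 - \<epsilon>"
  shows "nondegenerate N (\<epsilon> * p_single) (update p N \<pi> y)"
proof -
  have N1: "1 \<le> N" using N by simp
  have post: "posterior N \<pi>" using assms by (simp add: nondegenerate_def)
  note step = post sortPM_subset[OF N1 post] noise_bounds(3,4)[OF post]
  have "\<epsilon> * p_single \<le> 1 - update p N \<pi> y i" if i: "i \<in> {1..N}" for i
  proof -
    have "\<epsilon> * p_single \<le> (1 - \<pi> i) * noise p N \<pi>"
      using le_max_post[OF N1 post i] assms(2) \<epsilon> p_single noise_bounds(1)[OF post]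
      by (intro mult_mono) auto
    also have "\<dots> \<le> 1 - update p N \<pi> y i"
      unfolding update_def by (rule one_minus_update_ge[OF step i])
    finally show ?thesis .
  qed
  then show ?thesis
    using posterior_update[OF step] by (simp add: nondegenerate_def update_def)
qed

text \<open>None of the four drifts is harmful, so it suffices that in each case a single one, times
  its coefficient, reaches 1. The cases follow the size of the largest entry \<open>M\<close> and
  that of the query.\<close>

lemma lyapunov_drift:
  assumes nd: "nondegenerate N (\<epsilon> * p_single) \<pi>"
  shows "(\<Sum>y\<in>UNIV. evid N \<pi> (sortPM N \<pi>) (noise p N \<pi>) y * lyapunov (update p N \<pi> y)) \<le> lyapunov \<pi> - 1"
proof -
  define S q where "S = sortPM N \<pi>" and "q = noise p N \<pi>"
  define \<sigma> where "\<sigma> = (\<Sum>i\<in>S. \<pi> i)"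
  define M where "M = max_post N \<pi>"
  have N1: "1 \<le> N" using N by simp
  have post: "posterior N \<pi>" using nd by (simp add: nondegenerate_def)
  have lt1: "\<pi> i < 1" if "i \<in> {1..N}" for i
  proof -
    have "0 < \<epsilon> * p_single" using \<epsilon> p_single by simp
    moreover have "\<epsilon> * p_single \<le> 1 - \<pi> i" using nd that unfolding nondegenerate_def by blast
    ultimately show ?thesis by linarith
  qed
  have q: "p_single \<le> q" "q \<le> p_half" "0 < q" "q < 1/2"
    using noise_bounds[OF post] by (auto simp: q_def)
  have SN: "S \<subseteq> {1..N}" unfolding S_def by (rule sortPM_subset[OF N1 post])
  note step = post SN q(3,4)
  obtain m where m: "m \<in> S" "\<pi> m = M"
    using max_in_sortPM[OF N1 post] by (auto simp: S_def M_def)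
  have mN: "m \<in> {1..N}" using m SN by blast
  let ?P = "evid N \<pi> S q True"
  have in_diff: "lik S q True i - ?P = (1 - \<sigma>) * (1 - 2 * q)" if "i \<in> S" for i
    unfolding \<sigma>_def by (rule lik_diff_in[OF step that])
  have out_diff: "lik S q True i - ?P = - \<sigma> * (1 - 2 * q)" if "i \<notin> S" for i
    unfolding \<sigma>_def by (rule lik_diff_out[OF step that])
  define dH where "dH = binent ?P - binent q"
  define dQ where "dQ = 2 * ((\<pi> m)\<^sup>2 * (lik S q True m - ?P)\<^sup>2)"
  have dH: "0 \<le> dH" using binent_evid_ge[OF step] by (simp add: dH_def)
  have dQ: "0 \<le> dQ" by (simp add: dQ_def)
  have G: "0 \<le> sqrt_sum N \<pi> / sqrt N" using sqrt_sum_nonneg[OF post] by simp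
  have drift: "(\<Sum>y\<in>UNIV. evid N \<pi> S q y * lyapunov (bayes_update N \<pi> S q y)) \<le> lyapunov \<pi> - 1"
    if "\<And>i. i \<in> {1..N} \<Longrightarrow> s \<le> (lik S q True i - ?P)\<^sup>2 / 4"
      and "log_sum N \<pi> + D \<le> (\<Sum>y\<in>UNIV. evid N \<pi> S q y * log_sum N (bayes_update N \<pi> S q y))"
      and "1 \<le> 1 / ((1 - e) * rate) * dH
        + 1 / ((1 - 2 * p_half)\<^sup>2 / 64 * (sqrt \<alpha> / 4)) * (s * (sqrt_sum N \<pi> / sqrt N))
        + 1 / (2 * (\<rho>\<^sup>2 * (\<rho> * (1 - 2 * p_half))\<^sup>2)) * dQ + 1 / ((1 - e) * C1 p_single) * D" for s D
  proof -
    have "(\<Sum>y\<in>UNIV. evid N \<pi> S q y * lyapunov (bayes_update N \<pi> S q y)) \<le> lyapunov \<pi> - (1 / ((1 - e) * rate) * dH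
        + 1 / ((1 - 2 * p_half)\<^sup>2 / 64 * (sqrt \<alpha> / 4)) * (s * (sqrt_sum N \<pi> / sqrt N))
        + 1 / (2 * (\<rho>\<^sup>2 * (\<rho> * (1 - 2 * p_half))\<^sup>2)) * dQ + 1 / ((1 - e) * C1 p_single) * D)"
      unfolding lyapunov_def dH_def dQ_def
      by (rule potential_drift[OF step lyapunov_coeff_pos[THEN less_imp_le] mN that(1,2)])
    then show ?thesis using that(3) by linarith
  qed
  have D0: "log_sum N \<pi> + 0 \<le> (\<Sum>y\<in>UNIV. evid N \<pi> S q y * log_sum N (bayes_update N \<pi> S q y))"
    using log_sum_nondecreasing[OF step lt1] by simp
  note nn = mult_nonneg_nonneg[OF lyapunov_coeff_pos(1)[THEN less_imp_le] dH]
    mult_nonneg_nonneg[OF lyapunov_coeff_pos(2)[THEN less_imp_le] G]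
    mult_nonneg_nonneg[OF lyapunov_coeff_pos(3)[THEN less_imp_le] dQ]
  consider "M > 1 - \<rho>" | "\<rho> \<le> M" "M \<le> 1 - \<rho>" | "M < \<rho>" by linarith
  then have "(\<Sum>y\<in>UNIV. evid N \<pi> S q y * lyapunov (bayes_update N \<pi> S q y)) \<le> lyapunov \<pi> - 1"
  proof cases
    \<comment> \<open>The query is \<open>{m}\<close>, so the noise is exactly
      \<open>p_single\<close>, and
      \<open>2 * \<pi> m - 1 > 1 - 2 * \<rho> \<ge> 1 - e\<close>.\<close>
    case 1
    then have "1/2 \<le> max_post N \<pi>" using \<rho> by (simp add: M_def)
    then obtain m' where m': "S = {m'}"
      unfolding S_def by (rule sortPM_singleton[OF N1 post])
    then have Sm: "S = {m}" using m by simp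
    then have "q = p_single" by (simp add: q_def noise_def flip: S_def)
    have C: "C1 p_single = (1 - 2 * q) * ln ((1 - q) / q)"
      using q by (simp add: C1_eq flip: \<open>q = p_single\<close>)
    show ?thesis
    proof (rule drift)
      show "log_sum N \<pi> + (2 * \<pi> m - 1) * C1 p_single
        \<le> (\<Sum>y\<in>UNIV. evid N \<pi> S q y * log_sum N (bayes_update N \<pi> S q y))"
        unfolding C by (rule log_sum_drift[OF step lt1 Sm])
      have "(1 - e) * C1 p_single \<le> (2 * \<pi> m - 1) * C1 p_single"
        using 1 \<rho> m C1_pos[OF p_single(1,3)] by (intro mult_right_mono) auto
      then have "1 \<le> 1 / ((1 - e) * C1 p_single) * ((2 * \<pi> m - 1) * C1 p_single)"
        using e C1_pos[OF p_single(1,3)] by (intro mult_inverse_ge_1) auto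
      then show "1 \<le> 1 / ((1 - e) * rate) * dH
        + 1 / ((1 - 2 * p_half)\<^sup>2 / 64 * (sqrt \<alpha> / 4)) * (0 * (sqrt_sum N \<pi> / sqrt N))
        + 1 / (2 * (\<rho>\<^sup>2 * (\<rho> * (1 - 2 * p_half))\<^sup>2)) * dQ
        + 1 / ((1 - e) * C1 p_single) * ((2 * \<pi> m - 1) * C1 p_single)"
        using nn by linarith
    qed simp
  next
    case 2
    \<comment> \<open>A singleton query leaves mass \<open>1 - M \<ge> \<rho>\<close> outside, a
      balanced one at least 1/4. So the gap at \<open>m\<close> is at least
      \<open>\<rho> * (1 - 2 * q)\<close>.\<close>
    have \<sigma>_le: "\<rho> \<le> 1 - \<sigma>"
    proof (cases "1/2 \<le> M")
      case True
      then obtain m' where "S = {m'}"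
        unfolding S_def M_def by (rule sortPM_singleton[OF N1 post])
      then have "\<sigma> = M" using m by (simp add: \<sigma>_def)
      then show ?thesis using 2 by simp
    next
      case False
      then have "\<bar>\<sigma> - 1/2\<bar> \<le> M / 2"
        unfolding \<sigma>_def S_def M_def by (intro sum_sortPM_near_half[OF N1 post]) simp
      then show ?thesis using False \<rho> by linarith
    qed
    show ?thesis
    proof (rule drift[OF _ D0])
      have "\<rho>\<^sup>2 * (\<rho> * (1 - 2 * p_half))\<^sup>2 \<le> (\<pi> m)\<^sup>2 * (lik S q True m - ?P)\<^sup>2"
        unfolding in_diff[OF m(1)] using \<rho> 2 m q p_half \<sigma>_le
        by (intro mult_mono power_mono) auto
      then have "1 \<le> 1 / (2 * (\<rho>\<^sup>2 * (\<rho> * (1 - 2 * p_half))\<^sup>2)) * dQ"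
        unfolding dQ_def using \<rho> p_half by (intro mult_inverse_ge_1) auto
      then show "1 \<le> 1 / ((1 - e) * rate) * dH
        + 1 / ((1 - 2 * p_half)\<^sup>2 / 64 * (sqrt \<alpha> / 4)) * (0 * (sqrt_sum N \<pi> / sqrt N))
        + 1 / (2 * (\<rho>\<^sup>2 * (\<rho> * (1 - 2 * p_half))\<^sup>2)) * dQ + 1 / ((1 - e) * C1 p_single) * 0"
        using nn by linarith
    qed simp
  next
    case 3
    have \<sigma>: "\<bar>\<sigma> - 1/2\<bar> \<le> M / 2"
      unfolding \<sigma>_def S_def M_def
      by (rule sum_sortPM_near_half[OF N1 post]) (use 3 \<rho> in \<open>simp add: M_def\<close>)
    show ?thesis
    proof (cases "\<alpha> * N \<le> card S")
      case True
      have \<sigma>4: "1/4 \<le> \<sigma>" "1/4 \<le> 1 - \<sigma>" using \<sigma> 3 \<rho> by linarith+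
      \<comment> \<open>Both sides of the query carry mass at least 1/4, so every gap is at least a
        quarter of \<open>1 - 2 * p_half\<close>; squaring and dividing by 4 gives the 64.\<close>
      have s: "(1 - 2 * p_half)\<^sup>2 / 64 \<le> (lik S q True i - ?P)\<^sup>2 / 4" if "i \<in> {1..N}" for i
      proof -
        have "(1/4 * (1 - 2 * p_half))\<^sup>2 \<le> \<bar>lik S q True i - ?P\<bar>\<^sup>2"
        proof (rule power_mono)
          show "1/4 * (1 - 2 * p_half) \<le> \<bar>lik S q True i - ?P\<bar>"
          proof (cases "i \<in> S")
            case True
            show ?thesis unfolding in_diff[OF True] abs_mult
              using \<sigma>4 q p_half by (intro mult_mono) auto
          next
            case False
            show ?thesis unfolding out_diff[OF False] abs_mult
              using \<sigma>4 q p_half by (intro mult_mono) auto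
          qed
        qed (use p_half in simp)
        then show ?thesis by (simp add: power_mult_distrib power_divide)
      qed
      have "sqrt \<alpha> / 4 \<le> sqrt_sum N \<pi> / sqrt N"
      proof (rule sqrt_sum_ge[OF N1 post \<alpha>(1)])
        show "\<alpha> * N \<le> card (sortPM N \<pi>)" using True by (simp add: S_def)
        show "(\<Sum>i\<in>sortPM N \<pi>. \<pi> i) \<le> 3/4" using \<sigma>4 unfolding \<sigma>_def S_def by linarith
      qed
      then have "1 \<le> 1 / ((1 - 2 * p_half)\<^sup>2 / 64 * (sqrt \<alpha> / 4)) * ((1 - 2 * p_half)\<^sup>2 / 64 * (sqrt_sum N \<pi> / sqrt N))"
        using \<alpha> p_half by (intro mult_inverse_ge_1 mult_left_mono) auto
      then have gain: "1 \<le> 1 / ((1 - e) * rate) * dH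
        + 1 / ((1 - 2 * p_half)\<^sup>2 / 64 * (sqrt \<alpha> / 4)) * ((1 - 2 * p_half)\<^sup>2 / 64 * (sqrt_sum N \<pi> / sqrt N))
        + 1 / (2 * (\<rho>\<^sup>2 * (\<rho> * (1 - 2 * p_half))\<^sup>2)) * dQ + 1 / ((1 - e) * C1 p_single) * 0"
        using nn by linarith
      show ?thesis by (rule drift[OF s D0 gain])
    next
      case False
      have "card S / real N \<le> \<alpha>" using False N by (simp add: field_simps)
      moreover have "0 < card S" using m SN finite_subset[OF SN] by (auto simp: card_gt_0_iff)
      ultimately have "q \<le> p \<alpha>"
        unfolding q_def noise_def S_def[symmetric] using N \<alpha> by (intro p_le) auto
      then have hq: "binent q \<le> binent (p \<alpha>)"
        using q p_range[rule_format, of \<alpha>] \<alpha> by (intro binent_mono) auto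
      \<comment> \<open>The query is balanced up to \<open>\<rho>\<close>, so the entropy of the
        answer falls short of \<open>ln 2\<close> by at most \<open>\<rho>\<^sup>2\<close>, which is
        absorbed by the factor \<open>1 - e\<close> on the rate.\<close>
      have P: "2 * ?P - 1 = (2 * \<sigma> - 1) * (1 - 2 * q)"
        unfolding evid_True[OF step] \<sigma>_def by (simp add: algebra_simps)
      have "\<bar>2 * \<sigma> - 1\<bar> \<le> \<rho>" using \<sigma> 3 by linarith
      then have "\<bar>2 * ?P - 1\<bar> \<le> \<rho> * 1"
        unfolding P abs_mult using q \<rho> by (intro mult_mono) auto
      then have "(2 * ?P - 1)\<^sup>2 \<le> \<rho>\<^sup>2" using \<rho> by (simp add: abs_le_square_iff[symmetric])
      moreover have "ln 2 - (2 * ?P - 1)\<^sup>2 \<le> binent ?P"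
        by (rule binent_ge[OF evid_pos[OF step] evid_lt1[OF step]])
      ultimately have "(1 - e) * rate \<le> dH"
        using \<rho>(4) hq by (simp add: dH_def left_diff_distrib)
      then have "1 \<le> 1 / ((1 - e) * rate) * dH" using e rate_pos by (intro mult_inverse_ge_1) auto
      then have gain: "1 \<le> 1 / ((1 - e) * rate) * dH
        + 1 / ((1 - 2 * p_half)\<^sup>2 / 64 * (sqrt \<alpha> / 4)) * (0 * (sqrt_sum N \<pi> / sqrt N))
        + 1 / (2 * (\<rho>\<^sup>2 * (\<rho> * (1 - 2 * p_half))\<^sup>2)) * dQ + 1 / ((1 - e) * C1 p_single) * 0"
        using nn by linarith
      show ?thesis by (rule drift[OF _ D0 gain]) simp
    qed
  qed
  then show ?thesis by (simp add: S_def q_def update_def)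
qed

lemma nondegenerate_uniform: "nondegenerate N (\<epsilon> * p_single) (uniform N)"
proof -
  have "\<epsilon> * p_single \<le> 1 * (1/2)" using \<epsilon> p_single by (intro mult_mono) auto
  moreover have "1 / real N \<le> 1/2" using N by (simp add: field_simps)
  ultimately have "\<epsilon> * p_single \<le> 1 - 1 / real N" by linarith
  then show ?thesis
    using N by (simp add: nondegenerate_def posterior_def uniform_def)
qed

lemma lyapunov_uniform_le: "lyapunov (uniform N) \<le> ln N / ((1 - e) * rate)
    + 1 / ((1 - 2 * p_half)\<^sup>2 / 64 * (sqrt \<alpha> / 4)) + 1 / (2 * (\<rho>\<^sup>2 * (\<rho> * (1 - 2 * p_half))\<^sup>2))
    + (ln (1 / (\<epsilon> * p_single)) + 2) / ((1 - e) * C1 p_single)"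
proof -
  have N0: "0 < real N" using N by simp
  have "entropy N (uniform N) = ln N" "sqrt_sum N (uniform N) / sqrt N = 1"
    using N0 by (simp_all add: entropy_def sqrt_sum_def uniform_def ln_div real_sqrt_divide)
  moreover have "0 \<le> log_sum N (uniform N)"
    unfolding log_sum_def uniform_def using N by (intro sum_nonneg) (auto simp: field_simps)
  ultimately show ?thesis
    unfolding lyapunov_def potential_def using lyapunov_coeff_pos[THEN less_imp_le] square_sum_nonneg[of N "uniform N"]
    by (simp add: add_mono mult_left_le divide_right_mono)
qed

lemma expected_tau_bound: "expected_tau p N \<epsilon> \<le> ennreal (ln N / ((1 - e) * rate)
    + 1 / ((1 - 2 * p_half)\<^sup>2 / 64 * (sqrt \<alpha> / 4)) + 1 / (2 * (\<rho>\<^sup>2 * (\<rho> * (1 - 2 * p_half))\<^sup>2))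
    + (ln (1 / (\<epsilon> * p_single)) + 2) / ((1 - e) * C1 p_single))"
proof (rule expected_tau_le)
  fix n
  have "(\<Sum>i\<in>{1..N}. uniform N i * (\<Sum>t<n. alive p N \<epsilon> t (i, uniform N))) \<le> lyapunov (uniform N)"
  proof (rule lyapunov_bound[where G = "nondegenerate N (\<epsilon> * p_single)"])
    show "0 < noise p N \<pi> \<and> noise p N \<pi> < 1" if "nondegenerate N (\<epsilon> * p_single) \<pi>" for \<pi>
      using noise_bounds[of \<pi>] that by (simp add: nondegenerate_def)
    show "posterior N \<pi>" if "nondegenerate N (\<epsilon> * p_single) \<pi>" for \<pi>
      using that by (simp add: nondegenerate_def)
  qed (auto intro: lyapunov_nonneg nondegenerate_update lyapunov_drift nondegenerate_uniform)
  then show "(\<Sum>i\<in>{1..N}. uniform N i * (\<Sum>t<n. alive p N \<epsilon> t (i, uniform N))) \<le> ln N / ((1 - e) * rate)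
    + 1 / ((1 - 2 * p_half)\<^sup>2 / 64 * (sqrt \<alpha> / 4)) + 1 / (2 * (\<rho>\<^sup>2 * (\<rho> * (1 - 2 * p_half))\<^sup>2))
    + (ln (1 / (\<epsilon> * p_single)) + 2) / ((1 - e) * C1 p_single)"
    using lyapunov_uniform_le by (rule order_trans)
qed (use N in simp)

end

section \<open>The asymptotic bound\<close>

text \<open>The constant \<open>K\<close> is uniform in \<open>N\<close> and
  \<open>\<epsilon>\<close>: by monotonicity \<open>C1 (p (1 / real N))\<close> is at least
  \<open>C1 (p (1/2))\<close>, which bounds all that the two leading terms leave over.\<close>

lemma expected_tau_asymptotic_bound:
  fixes p :: "real \<Rightarrow> real" and \<alpha> e :: real
  assumes p_range: "\<forall>x\<in>{0<..<1}. 0 < p x \<and> p x < 1/2" and p_mono: "mono_on {0<..<1} p"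
    and \<alpha>: "0 < \<alpha>" "\<alpha> < 1" and e: "0 < e" "e < 1"
  obtains K where "0 \<le> K"
    "\<And>N \<epsilon>. 2 \<le> N \<Longrightarrow> 0 < \<epsilon> \<Longrightarrow> \<epsilon> < 1 \<Longrightarrow> expected_tau p N \<epsilon> \<le>
      ennreal ((ln N / I_bsc (1/2) (p \<alpha>) + ln (1 / \<epsilon>) / C1 (p (1 / real N))) / (1 - e) + K)"
proof -
  define R where "R = ln 2 - binent (p \<alpha>)"
  have p\<alpha>: "0 < p \<alpha>" "p \<alpha> < 1/2" using p_range \<alpha> by auto
  have R: "0 < R" using binent_less_ln2[OF p\<alpha>] by (simp add: R_def)
  have I: "I_bsc (1/2) (p \<alpha>) = R" using p\<alpha> by (simp add: I_bsc_half R_def)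
  have h: "0 < p (1/2)" "p (1/2) < 1/2" using p_range by auto
  \<comment> \<open>\<open>e / 4\<close> secures \<open>\<rho> \<le> 1/4\<close> and
    \<open>2 * \<rho> \<le> e\<close>; \<open>e * R\<close> secures
    \<open>\<rho>\<^sup>2 \<le> e * R\<close>, through
    \<open>\<rho>\<^sup>2 \<le> \<rho>\<close>.\<close>
  define \<rho> where "\<rho> = min (e / 4) (e * R)"
  have "\<rho> \<le> e / 4" by (simp add: \<rho>_def)
  moreover have "0 < \<rho>" using e R by (simp add: \<rho>_def)
  ultimately have \<rho>: "0 < \<rho>" "\<rho> \<le> 1/4" "2 * \<rho> \<le> e" using e by linarith+
  have "\<rho>\<^sup>2 \<le> \<rho>" using \<rho> by (simp add: power2_eq_square mult_left_le)
  then have \<rho>4: "\<rho>\<^sup>2 \<le> e * (ln 2 - binent (p \<alpha>))" using min.cobounded2[of "e / 4" "e * R"] unfolding \<rho>_def R_def by linarith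
  define A where "A = 1 / ((1 - 2 * p (1/2))\<^sup>2 / 64 * (sqrt \<alpha> / 4)) + 1 / (2 * (\<rho>\<^sup>2 * (\<rho> * (1 - 2 * p (1/2)))\<^sup>2))"
  \<comment> \<open>\<open>B\<close> bounds \<open>(ln (1 / q) + 2) / C1 q\<close> for
    \<open>q = p (1 / real N)\<close>, uniformly in \<open>N\<close>.\<close>
  define B where "B = 1 / (1 - 2 * p (1/2)) + (ln 2 + 2) / C1 (p (1/2))"
  have Ch: "0 < C1 (p (1/2))" using C1_pos[OF h] .
  show ?thesis
  proof (rule that[of "A + B / (1 - e)"])
    show "0 \<le> A + B / (1 - e)"
      using e h \<alpha> \<rho> Ch by (auto simp: A_def B_def intro!: add_nonneg_nonneg divide_nonneg_nonneg)
    fix N :: nat and \<epsilon> :: real assume N: "2 \<le> N" and \<epsilon>: "0 < \<epsilon>" "\<epsilon> < 1"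
    define q where "q = p (1 / real N)"
    have q: "0 < q" "q \<le> p (1/2)" "q < 1/2"
      using p_single[OF p_range p_mono \<alpha> e \<rho> \<rho>4 N \<epsilon>] by (auto simp: q_def)
    define C where "C = C1 q"
    have C: "0 < C" "C1 (p (1/2)) \<le> C" using C1_pos[OF q(1,3)] C1_mono[OF q(1,2) h(2)] by (auto simp: C_def)
    have "ln (1 / (\<epsilon> * q)) + 2 = ln (1 / \<epsilon>) + (ln (1 / q) + 2)"
      using \<epsilon> q by (simp add: ln_div ln_mult)
    also have "\<dots> \<le> ln (1 / \<epsilon>) + (C * (1 / (1 - 2 * p (1/2))) + (ln 2 + 2))"
      using ln_inverse_le_C1[OF q(1,2) h(2)] by (simp add: C_def)
    finally have "(ln (1 / (\<epsilon> * q)) + 2) / C \<le> (ln (1 / \<epsilon>) + (C * (1 / (1 - 2 * p (1/2))) + (ln 2 + 2))) / C"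
      using C by (intro divide_right_mono) auto
    also have "\<dots> = ln (1 / \<epsilon>) / C + (1 / (1 - 2 * p (1/2)) + (ln 2 + 2) / C)"
      using C by (simp add: add_divide_distrib)
    also have "(ln 2 + 2) / C \<le> (ln 2 + 2) / C1 (p (1/2))"
      using C Ch by (intro divide_left_mono) auto
    finally have "(ln (1 / (\<epsilon> * q)) + 2) / C \<le> ln (1 / \<epsilon>) / C + B" by (simp add: B_def)
    then have "(ln (1 / (\<epsilon> * q)) + 2) / C / (1 - e) \<le> (ln (1 / \<epsilon>) / C + B) / (1 - e)"
      using e by (intro divide_right_mono) auto
    then have le: "ln N / ((1 - e) * R) + A + (ln (1 / (\<epsilon> * q)) + 2) / ((1 - e) * C)
        \<le> (ln N / R + ln (1 / \<epsilon>) / C) / (1 - e) + (A + B / (1 - e))"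
      by (simp add: add_divide_distrib mult.commute)
    have "expected_tau p N \<epsilon> \<le> ennreal (ln N / ((1 - e) * R) + A + (ln (1 / (\<epsilon> * q)) + 2) / ((1 - e) * C))"
      using expected_tau_bound[OF p_range p_mono \<alpha> e \<rho> \<rho>4 N \<epsilon>] by (simp only: R_def A_def C_def q_def add.assoc)
    also have "\<dots> \<le> ennreal ((ln N / R + ln (1 / \<epsilon>) / C) / (1 - e) + (A + B / (1 - e)))"
      using le by (rule ennreal_leI)
    finally show "expected_tau p N \<epsilon> \<le>
      ennreal ((ln N / I_bsc (1/2) (p \<alpha>) + ln (1 / \<epsilon>) / C1 (p (1 / real N))) / (1 - e) + (A + B / (1 - e)))"
      by (simp only: I C_def q_def)
  qed
qed

theorem theorem1:
  fixes p :: "real \<Rightarrow> real" and \<alpha> :: real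
  assumes p_range: "\<forall>x\<in>{0<..<1}. 0 < p x \<and> p x < 1/2"
    and p_cont: "continuous_on {0<..<1} p"
    and p_mono: "mono_on {0<..<1} p"
    and \<alpha>_pos: "0 < \<alpha>" and \<alpha>_lt1: "\<alpha> < 1"
  shows "\<exists>r :: nat \<Rightarrow> real \<Rightarrow> real.
    (\<forall>\<eta>>0. \<exists>\<rho>>0. \<forall>N \<epsilon>. 2 \<le> N \<longrightarrow> 0 < \<epsilon> \<longrightarrow> \<epsilon> < 1 \<longrightarrow> (1 / real N) * \<epsilon> < \<rho> \<longrightarrow>
        \<bar>r N \<epsilon>\<bar> \<le> \<eta> * ln (1 / ((1 / real N) * \<epsilon>))) \<and>
    (\<forall>N \<epsilon>. 2 \<le> N \<longrightarrow> 0 < \<epsilon> \<longrightarrow> \<epsilon> < 1 \<longrightarrow>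
        \<alpha> > (exp 1 * ln (1 / ((1 / real N) * \<epsilon>))) powr (- Ks p) \<longrightarrow>
        expected_tau p N \<epsilon> \<le> ennreal (ln (1 / (1 / real N)) / I_bsc (1/2) (p \<alpha>)
            + ln (1 / \<epsilon>) / C1 (p (1 / real N)) + r N \<epsilon>))"
proof -
  define I where "I = I_bsc (1/2) (p \<alpha>)"
  define main where "main N \<epsilon> = ln N / I + ln (1 / \<epsilon>) / C1 (p (1 / real N))" for N \<epsilon>
  \<comment> \<open>Taking the actual excess over the leading terms gives one remainder for all
    \<open>\<eta>\<close>. As \<open>enn2real\<close> sends infinity to 0, finiteness of the
    expectation has to be shown separately, in \<open>le\<close>.\<close>
  define r where "r N \<epsilon> = max 0 (enn2real (expected_tau p N \<epsilon>) - main N \<epsilon>)" for N \<epsilon>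
  note bound = expected_tau_asymptotic_bound[OF p_range p_mono \<alpha>_pos \<alpha>_lt1]
  have p\<alpha>: "0 < p \<alpha>" "p \<alpha> < 1/2" using p_range \<alpha>_pos \<alpha>_lt1 by auto
  have I: "0 < I" using binent_less_ln2[OF p\<alpha>] p\<alpha> by (simp add: I_def I_bsc_half)
  have h: "0 < p (1/2)" "p (1/2) < 1/2" using p_range by auto
  \<comment> \<open>\<open>Q * ln (N / \<epsilon>)\<close> dominates the leading terms, so a
    relative error in them is a small multiple of \<open>ln (N / \<epsilon>)\<close>.\<close>
  define Q where "Q = 1 / I + 1 / C1 (p (1/2))"
  have Q: "0 < Q" using I C1_pos[OF h] by (simp add: Q_def add_pos_pos)
  have main: "0 \<le> main N \<epsilon>" "main N \<epsilon> \<le> Q * ln (N / \<epsilon>)" if N: "2 \<le> N" "0 < \<epsilon>" "\<epsilon> < 1" for N \<epsilon>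
  proof -
    have "p (1 / real N) \<le> p (1/2)" "0 < p (1 / real N)"
      using p_mono p_range N by (auto simp: mono_on_def field_simps)
    then have C: "C1 (p (1/2)) \<le> C1 (p (1 / real N))" using C1_mono h by blast
    have Ch: "0 < C1 (p (1/2))" using C1_pos[OF h] .
    have l: "0 \<le> ln N" "0 \<le> ln (1 / \<epsilon>)" using N by auto
    show "0 \<le> main N \<epsilon>" using l I C Ch unfolding main_def by (intro add_nonneg_nonneg divide_nonneg_nonneg) auto
    have "ln (1 / \<epsilon>) / C1 (p (1 / real N)) \<le> ln (1 / \<epsilon>) / C1 (p (1/2))"
      using l C Ch by (intro divide_left_mono) auto
    moreover have "ln (N / \<epsilon>) = ln N + ln (1 / \<epsilon>)" using N by (simp add: ln_div)
    moreover have "0 \<le> ln (1 / \<epsilon>) / I" "0 \<le> ln N / C1 (p (1/2))" using l I Ch by auto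
    ultimately show "main N \<epsilon> \<le> Q * ln (N / \<epsilon>)" by (simp add: main_def Q_def distrib_right add_divide_distrib)
  qed
  have small: "\<exists>\<rho>>0. \<forall>N \<epsilon>. 2 \<le> N \<longrightarrow> 0 < \<epsilon> \<longrightarrow> \<epsilon> < 1 \<longrightarrow> (1 / real N) * \<epsilon> < \<rho> \<longrightarrow>
      \<bar>r N \<epsilon>\<bar> \<le> \<eta> * ln (1 / ((1 / real N) * \<epsilon>))" if \<eta>: "0 < \<eta>" for \<eta>
  proof -
    \<comment> \<open>Half of \<open>\<eta>\<close> pays for the factor
      \<open>1 / (1 - e) \<le> 1 + 2 * e\<close>, through \<open>2 * e * Q \<le> \<eta> / 2\<close>;
      the other half pays for the constant \<open>K\<close>.\<close>
    define e where "e = min (1/2) (\<eta> / (4 * Q))"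
    have e: "0 < e" "e < 1" "e \<le> 1/2" using \<eta> Q by (auto simp: e_def)
    have "e \<le> \<eta> / (4 * Q)" by (simp add: e_def)
    then have eQ: "2 * e * Q \<le> \<eta> / 2" using Q by (simp add: field_simps)
    obtain K where K: "0 \<le> K" "\<And>N \<epsilon>. 2 \<le> N \<Longrightarrow> 0 < \<epsilon> \<Longrightarrow> \<epsilon> < 1 \<Longrightarrow>
        expected_tau p N \<epsilon> \<le> ennreal (main N \<epsilon> / (1 - e) + K)"
      using bound[OF e(1,2)] unfolding main_def I_def by blast
    \<comment> \<open>Below this threshold \<open>ln (N / \<epsilon>)\<close> exceeds
      \<open>2 * K / \<eta>\<close>.\<close>
    show ?thesis
    proof (intro exI[of _ "exp (- (2 * K / \<eta>))"] conjI allI impI)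
      fix N :: nat and \<epsilon> :: real
      assume N: "2 \<le> N" "0 < \<epsilon>" "\<epsilon> < 1" and "(1 / real N) * \<epsilon> < exp (- (2 * K / \<eta>))"
      then have "ln ((1 / real N) * \<epsilon>) < ln (exp (- (2 * K / \<eta>)))" by (subst ln_less_cancel_iff) auto
      then have "ln ((1 / real N) * \<epsilon>) < - (2 * K / \<eta>)" by (simp only: ln_exp)
      moreover have L: "ln (1 / ((1 / real N) * \<epsilon>)) = ln (N / \<epsilon>)" "ln ((1 / real N) * \<epsilon>) = - ln (N / \<epsilon>)"
        using N by (simp_all add: ln_div ln_mult)
      ultimately have KL: "K \<le> \<eta> / 2 * ln (N / \<epsilon>)" using \<eta> by (simp add: field_simps)
      have "1 / (1 - e) \<le> 1 + 2 * e"
      proof -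
        have "e * (2 * e) \<le> e * 1" using e by (intro mult_left_mono) auto
        then show ?thesis using e by (simp add: divide_le_eq algebra_simps)
      qed
      then have "main N \<epsilon> * (1 / (1 - e)) \<le> main N \<epsilon> * (1 + 2 * e)"
        using main(1)[OF N] by (rule mult_left_mono)
      moreover have "2 * e * main N \<epsilon> \<le> \<eta> / 2 * ln (N / \<epsilon>)"
      proof -
        have "2 * e * main N \<epsilon> \<le> 2 * e * (Q * ln (N / \<epsilon>))" using e main(2)[OF N] by (intro mult_left_mono) auto
        also have "\<dots> = 2 * e * Q * ln (N / \<epsilon>)" by simp
        also have "\<dots> \<le> \<eta> / 2 * ln (N / \<epsilon>)" using eQ N by (intro mult_right_mono) auto
        finally show ?thesis .
      qed
      moreover have "enn2real (expected_tau p N \<epsilon>) \<le> main N \<epsilon> / (1 - e) + K"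
        using K(2)[OF N] K(1) main(1)[OF N] e by (intro enn2real_leI) auto
      ultimately have "enn2real (expected_tau p N \<epsilon>) - main N \<epsilon> \<le> \<eta> * ln (N / \<epsilon>)"
        using KL by (simp add: algebra_simps)
      moreover have "0 \<le> \<eta> * ln (N / \<epsilon>)" using \<eta> N by simp
      ultimately show "\<bar>r N \<epsilon>\<bar> \<le> \<eta> * ln (1 / ((1 / real N) * \<epsilon>))"
        unfolding L r_def by simp
    qed simp
  qed
  have le: "expected_tau p N \<epsilon> \<le> ennreal (main N \<epsilon> + r N \<epsilon>)" if N: "2 \<le> N" "0 < \<epsilon>" "\<epsilon> < 1" for N \<epsilon>
  proof -
    \<comment> \<open>One fixed value of \<open>e\<close>, here 1/2, already shows that the
      expectation is finite.\<close>
    obtain K where "expected_tau p N \<epsilon> \<le> ennreal K"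
      using bound[of "1/2"] N by (metis half_gt_zero field_sum_of_halves less_add_same_cancel1 zero_less_one)
    then have "expected_tau p N \<epsilon> = ennreal (enn2real (expected_tau p N \<epsilon>))"
      by (metis ennreal_enn2real ennreal_less_top le_less_trans)
    also have "\<dots> \<le> ennreal (main N \<epsilon> + r N \<epsilon>)" by (intro ennreal_leI) (simp add: r_def)
    finally show ?thesis .
  qed
  show ?thesis
    using small le by (intro exI[of _ r]) (simp add: main_def I_def)
qed

end
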